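(* Let $\beta_1,\beta_2>0$, $\beta_1\neq\beta_2$, and $\mathfrak q=e^{\beta_1-\beta_2}$. Fix $A,B>0$ and take two $1$-Lipschitz monotone functions $\chi:[0,A]\to\mathbb R$, $\psi:[0,B]\to\mathbb R$ such that $\chi(0)=\psi(0)$. For each $L$ consider the stochastic six-vertex model in the quadrant with parameters $b=\exp(-\beta_1/L)$, $qb=\exp(-\beta_2/L)$ and with a deterministic boundary condition (depending on $L$) chosen so that, as $L\to\infty$, $\frac1L H(Lx,0)\to\chi(x)$ and $\frac1L H(0,Ly)\to\psi(y)$ uniformly on $x\in[0,A]$, $y\in[0,B]$. Define the function $\mathfrak q^{\mathbf h}:[0,A]\times[0,B]\to\mathbb R$ as the solution to the PDE $$\frac{\partial^2}{\partial x\partial y}\bigl(\mathfrak q^{\mathbf h(x,y)}\bigr)+\beta_2\frac{\partial}{\partial x}\bigl(\mathfrak q^{\mathbf h(x,y)}\bigr)+\beta_1\frac{\partial}{\partial y}\bigl(\mathfrak q^{\mathbf h(x,y)}\bigr)=0,\qquad \mathfrak q^{\mathbf h(x,0)}=\mathfrak q^{\chi(x)},\quad \mathfrak q^{\mathbf h(0,y)}=\mathfrak q^{\psi(y)}.$$ Then the height function satisfies the Law of Large Numbers $$\lim_{L\to\infty}\ \sup_{(x,y)\in[0,A]\times[0,B]}\left|\frac1L H(Lx,Ly)-\mathbf h(x,y)\right|=0\qquad\text{in probability}.$$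
   Context: **Stochastic six-vertex model.** Parameters $0<b<1$, $q>0$ with $bq<1$. Vertices are the points of $\mathbb Z_{\ge1}^2$. A boundary condition specifies for which $j\ge1$ a path enters the vertex $(1,j)$ from the left and for which $i\ge1$ a path enters the vertex $(i,1)$ from below. The configuration of up-right paths is built sequentially from the bottom-left corner; at each vertex, given the incoming paths, the outgoing paths are sampled independently of everything else: no incoming paths produce no outgoing paths; two incoming paths (left and below) produce two outgoing paths (right and up); a single path from the left exits right with probability $b$ and up with probability $1-b$; a single path from below exits up with probability $bq$ and right with probability $1-bq$. **Height function.** $H(x,y)$, $(x,y)\in\mathbb Z_{\ge0}^2$, is attached to the face with center $(x+\frac12,y+\frac12)$: $H(0,0)=0$; $H(x,y)-H(x,y-1)$ equals $1$ if a path occupies the horizontal edge joining $(x,y)$ to $(x+1,y)$ (for $x=0$: if a path enters $(1,y)$ from the left) and $0$ otherwise; $H(x,y)-H(x-1,y)$ equals $-1$ if a path occupies the vertical edge joining $(x,y)$ to $(x,y+1)$ (for $y=0$: if a path enters $(x,1)$ from below) and $0$ otherwise. $H$ is extended to real arguments first linearly in the $x$-direction and then linearly in the $y$-direction. **Meaning of the PDE.** When the boundary data are not continuously differentiable, the PDE for $f=\mathfrak q^{\mathbf h}$ is understood in its integrated form: $f$ is the unique continuous function with the given boundary values such that for all $(X,Y)\in[0,A]\times[0,B]$ $$f(X,Y)-f(X,0)-f(0,Y)+f(0,0)+\beta_2\int_0^Y\bigl(f(X,y)-f(0,y)\bigr)dy+\beta_1\int_0^X\bigl(f(x,Y)-f(x,0)\bigr)dx=0.$$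 *)

theory Defs
  imports "HOL-Probability.Probability"
begin

section \<open>The stochastic six-vertex model in the quadrant\<close>

text \<open>
  The randomness is an independent family \<open>\<omega>\<close> of pairs of independent coins, one pair per vertex.
  At a vertex with a single incoming path, the first coin decides whether a path
  from the left continues to the right, the second one whether a path from below continues upwards.
  The coins at sites outside the positive quadrant are never used.
\<close>

definition vertex_coins :: "real \<Rightarrow> real \<Rightarrow> (bool \<times> bool) pmf" where
  "vertex_coins b q = pair_pmf (bernoulli_pmf b) (bernoulli_pmf (b * q))"

definition six_vertex_space :: "real \<Rightarrow> real \<Rightarrow> (nat \<times> nat \<Rightarrow> bool \<times> bool) measure" where
  "six_vertex_space b q = (\<Pi>\<^sub>M v\<in>UNIV. measure_pmf (vertex_coins b q))"

text \<open>
  Arguments: the coins, presence of a path entering from the left, presence of a path entering from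
  below. Result: presence of a path leaving to the right, presence of a path leaving upwards.
\<close>

fun vertex_out :: "bool \<times> bool \<Rightarrow> bool \<Rightarrow> bool \<Rightarrow> bool \<times> bool" where
  "vertex_out (s, t) l d =
     (if l = d then (l, d) else if l then (s, \<not> s) else (\<not> t, t))"

lemma map_vertex_out_vertex_coins:
  "map_pmf (\<lambda>c. vertex_out c False False) (vertex_coins b q) = return_pmf (False, False)"
  "map_pmf (\<lambda>c. vertex_out c True True) (vertex_coins b q) = return_pmf (True, True)"
  "map_pmf (\<lambda>c. vertex_out c True False) (vertex_coins b q) =
     map_pmf (\<lambda>s. (s, \<not> s)) (bernoulli_pmf b)"
  "map_pmf (\<lambda>c. vertex_out c False True) (vertex_coins b q) =
     map_pmf (\<lambda>t. (\<not> t, t)) (bernoulli_pmf (b * q))"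
proof -
  have fst_snd:
    "map_pmf fst (vertex_coins b q) = bernoulli_pmf b"
    "map_pmf snd (vertex_coins b q) = bernoulli_pmf (b * q)"
    by (simp_all add: vertex_coins_def map_fst_pair_pmf map_snd_pair_pmf)
  have out:
    "(\<lambda>c. vertex_out c False False) = (\<lambda>_. (False, False))"
    "(\<lambda>c. vertex_out c True True) = (\<lambda>_. (True, True))"
    "(\<lambda>c. vertex_out c True False) = (\<lambda>s. (s, \<not> s)) \<circ> fst"
    "(\<lambda>c. vertex_out c False True) = (\<lambda>t. (\<not> t, t)) \<circ> snd"
    by (auto simp: fun_eq_iff)
  show
    "map_pmf (\<lambda>c. vertex_out c False False) (vertex_coins b q) = return_pmf (False, False)"
    "map_pmf (\<lambda>c. vertex_out c True True) (vertex_coins b q) = return_pmf (True, True)"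
    "map_pmf (\<lambda>c. vertex_out c True False) (vertex_coins b q) =
       map_pmf (\<lambda>s. (s, \<not> s)) (bernoulli_pmf b)"
    "map_pmf (\<lambda>c. vertex_out c False True) (vertex_coins b q) =
       map_pmf (\<lambda>t. (\<not> t, t)) (bernoulli_pmf (b * q))"
    unfolding out by (simp_all only: map_pmf_const pmf.map_comp[symmetric] fst_snd)
qed

text \<open>
  \<open>outgoing lft btm \<omega> x y\<close> tells whether the horizontal edge from \<open>(x, y)\<close> to \<open>(x + 1, y)\<close> and
  the vertical edge from \<open>(x, y)\<close> to \<open>(x, y + 1)\<close> are occupied. The boundary condition is encoded as
  the edges going out of the fictitious vertices on the axes: \<open>lft j\<close> for a path entering \<open>(1, j)\<close>
  from the left, \<open>btm i\<close> for a path entering \<open>(i, 1)\<close> from below (only \<open>i, j \<ge> 1\<close> matter).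
\<close>

fun outgoing ::
  "(nat \<Rightarrow> bool) \<Rightarrow> (nat \<Rightarrow> bool) \<Rightarrow> (nat \<times> nat \<Rightarrow> bool \<times> bool) \<Rightarrow> nat \<Rightarrow> nat \<Rightarrow> bool \<times> bool" where
  "outgoing lft btm \<omega> 0 y = (lft y, False)"
| "outgoing lft btm \<omega> (Suc x) 0 = (False, btm (Suc x))"
| "outgoing lft btm \<omega> (Suc x) (Suc y) =
     vertex_out (\<omega> (Suc x, Suc y))
       (fst (outgoing lft btm \<omega> x (Suc y))) (snd (outgoing lft btm \<omega> (Suc x) y))"

section \<open>Height function\<close>

text \<open>
  The height is summed along the bottom axis and then upwards. By conservation of paths at the
  vertices this is the function having the prescribed increments in both directions, see
  \<open>height_increments\<close> below.
\<close>

fun height ::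
  "(nat \<Rightarrow> bool) \<Rightarrow> (nat \<Rightarrow> bool) \<Rightarrow> (nat \<times> nat \<Rightarrow> bool \<times> bool) \<Rightarrow> nat \<Rightarrow> nat \<Rightarrow> int" where
  "height lft btm \<omega> 0 0 = 0"
| "height lft btm \<omega> (Suc x) 0 =
     height lft btm \<omega> x 0 - of_bool (snd (outgoing lft btm \<omega> (Suc x) 0))"
| "height lft btm \<omega> x (Suc y) =
     height lft btm \<omega> x y + of_bool (fst (outgoing lft btm \<omega> x (Suc y)))"

lemma vertex_out_conservation:
  "of_bool (fst (vertex_out c l d)) + of_bool (snd (vertex_out c l d)) =
     (of_bool l + of_bool d :: int)"
  by (cases c) auto

lemma height_increments:
  "height lft btm \<omega> 0 0 = 0"
  "height lft btm \<omega> x (Suc y) - height lft btm \<omega> x y =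
     of_bool (fst (outgoing lft btm \<omega> x (Suc y)))"
  "height lft btm \<omega> (Suc x) y - height lft btm \<omega> x y =
     - of_bool (snd (outgoing lft btm \<omega> (Suc x) y))"
proof -
  show "height lft btm \<omega> (Suc x) y - height lft btm \<omega> x y =
     - of_bool (snd (outgoing lft btm \<omega> (Suc x) y))"
  proof (induction y)
    case (Suc y)
    then show ?case
      using vertex_out_conservation[of "\<omega> (Suc x, Suc y)"
          "fst (outgoing lft btm \<omega> x (Suc y))" "snd (outgoing lft btm \<omega> (Suc x) y)"]
      by simp
  qed simp
qed simp_all

text \<open>Extension to nonnegative real arguments, linearly in \<open>x\<close> first and then linearly in \<open>y\<close>.\<close>

definition height_x ::
  "(nat \<Rightarrow> bool) \<Rightarrow> (nat \<Rightarrow> bool) \<Rightarrow> (nat \<times> nat \<Rightarrow> bool \<times> bool) \<Rightarrow> real \<Rightarrow> nat \<Rightarrow> real" where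
  "height_x lft btm \<omega> x n =
     (1 - frac x) * of_int (height lft btm \<omega> (nat \<lfloor>x\<rfloor>) n)
     + frac x * of_int (height lft btm \<omega> (nat \<lfloor>x\<rfloor> + 1) n)"

definition height_xy ::
  "(nat \<Rightarrow> bool) \<Rightarrow> (nat \<Rightarrow> bool) \<Rightarrow> (nat \<times> nat \<Rightarrow> bool \<times> bool) \<Rightarrow> real \<Rightarrow> real \<Rightarrow> real" where
  "height_xy lft btm \<omega> x y =
     (1 - frac y) * height_x lft btm \<omega> x (nat \<lfloor>y\<rfloor>)
     + frac y * height_x lft btm \<omega> x (nat \<lfloor>y\<rfloor> + 1)"

text \<open>On the axes the height does not depend on the coins.\<close>

lemma height_axes_deterministic:
  "height lft btm \<omega> x 0 = height lft btm \<omega>' x 0"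
  "height lft btm \<omega> 0 y = height lft btm \<omega>' 0 y"
proof -
  show "height lft btm \<omega> x 0 = height lft btm \<omega>' x 0"
    by (induction x) auto
  show "height lft btm \<omega> 0 y = height lft btm \<omega>' 0 y"
    by (induction y) auto
qed

lemma height_xy_axes_deterministic:
  "height_xy lft btm \<omega> x 0 = height_xy lft btm \<omega>' x 0"
  "height_xy lft btm \<omega> 0 y = height_xy lft btm \<omega>' 0 y"
  using height_axes_deterministic[of lft btm \<omega> _ \<omega>']
  by (simp_all add: height_xy_def height_x_def del: height.simps)

section \<open>The limiting equation\<close>

text \<open>
  Continuous solutions on \<open>[0, A] \<times> [0, B]\<close> of
  \<open>f\<^sub>x\<^sub>y + \<beta>\<^sub>2 f\<^sub>x + \<beta>\<^sub>1 f\<^sub>y = 0\<close>, \<open>f(x, 0) = u x\<close>, \<open>f(0, y) = v y\<close>, in the form integrated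
  over \<open>[0, X] \<times> [0, Y]\<close>, which makes sense for boundary data that are merely continuous.
\<close>

definition integrated_pde_solution ::
  "real \<Rightarrow> real \<Rightarrow> real \<Rightarrow> real \<Rightarrow> (real \<Rightarrow> real) \<Rightarrow> (real \<Rightarrow> real) \<Rightarrow> (real \<Rightarrow> real \<Rightarrow> real) \<Rightarrow> bool"
  where
  "integrated_pde_solution \<beta>\<^sub>1 \<beta>\<^sub>2 A B u v f \<longleftrightarrow>
     continuous_on ({0..A} \<times> {0..B}) (\<lambda>(x, y). f x y) \<and>
     (\<forall>x\<in>{0..A}. f x 0 = u x) \<and>
     (\<forall>y\<in>{0..B}. f 0 y = v y) \<and>
     (\<forall>X\<in>{0..A}. \<forall>Y\<in>{0..B}.
        f X Y - f X 0 - f 0 Y + f 0 0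
        + \<beta>\<^sub>2 * integral {0..Y} (\<lambda>y. f X y - f 0 y)
        + \<beta>\<^sub>1 * integral {0..X} (\<lambda>x. f x Y - f x 0) = 0)"

section \<open>Convergence to 0 in probability\<close>

text \<open>
  The probability space may change along the filter. Measurability is part of the definition, since
  \<^const>\<open>measure\<close> is 0 on non-measurable sets.
\<close>

definition tendsto_0_in_probability ::
  "('i \<Rightarrow> 'a measure) \<Rightarrow> ('i \<Rightarrow> 'a \<Rightarrow> real) \<Rightarrow> 'i filter \<Rightarrow> bool" where
  "tendsto_0_in_probability M X F \<longleftrightarrow>
     (\<forall>\<^sub>F i in F. X i \<in> borel_measurable (M i)) \<and>
     (\<forall>\<epsilon>>0. ((\<lambda>i. measure (M i) {\<omega> \<in> space (M i). \<bar>X i \<omega>\<bar> > \<epsilon>}) \<longlongrightarrow> 0) F)"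

end

theory Submission
  imports Defs "HOL-Real_Asymp.Real_Asymp"
begin

text \<open>
  Write \<open>\<gamma> = \<beta>\<^sub>1 - \<beta>\<^sub>2\<close>, so that \<open>q = exp (\<gamma> / L)\<close>. The nonlinear limit of the height becomes
  linear after exponentiation: by conservation of paths, at each vertex the four adjacent values of
  \<open>q\<close> to the power \<open>H\<close> satisfy
    \<open>F(x+1, y+1) - b F(x, y+1) - b q F(x+1, y) + (b + b q - 1) F(x, y) = \<xi>(x, y)\<close>,
  where the noise \<open>\<xi>\<close> has mean zero with respect to the coins of that vertex alone. Summed over a
  rectangle, the left-hand side is a discretization of the integrated equation for
  \<open>f = exp (\<gamma> h)\<close>, since \<open>1 - b\<close> and \<open>1 - b q\<close> are approximately \<open>\<beta>\<^sub>1 / L\<close> and \<open>\<beta>\<^sub>2 / L\<close>.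

  The noise is negligible. The noises of two different vertices are orthogonal, because one of the
  two vertices is not to the lower left of the other, so that its coins do not influence the other
  noise (\<open>noise_orthogonal\<close>). Each noise has variance of order \<open>L\<close> to the power \<open>-3\<close>: a factor
  \<open>(q - 1)\<^sup>2\<close> from the size of a jump of \<open>F\<close>, and a factor \<open>1 - b\<close> or \<open>1 - b q\<close> from the
  probability that a path turns. There are of order \<open>L\<^sup>2\<close> vertices, so the sum has
  variance of order \<open>1 / L\<close>, and Chebyshev's inequality controls it at any fixed point. As the height is 1-Lipschitz, the defect
  with which the rescaled \<open>F\<close> solves the integrated equation is Lipschitz uniformly in \<open>L\<close>, and
  finitely many points control it on the whole rectangle (\<open>defect_uniformly_small\<close>).

  The rest is deterministic. By a Gronwall argument in two variables, two approximate solutions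
  of the integrated equation differ by at most a constant times the sum of their errors
  (\<open>approx_solution_stability\<close>). This one estimate gives uniqueness, convergence in probability, and,
  because realizations of the model are approximate solutions with arbitrarily small error
  and hence form Cauchy sequences, also existence. All realizations are bounded below by a
  common positive constant. The limit inherits this bound, so its logarithm is defined, and passing to
  logarithms turns the convergence of \<open>F\<close> into convergence of the height.
\<close>

section \<open>Stability of the limiting equation\<close>

text \<open>
  The left-hand side of the integrated equation. Prescribing the values on the two axes, which are
  characteristics of the equation, is Goursat's problem.
\<close>

definition goursat_defect ::
  "real \<Rightarrow> real \<Rightarrow> (real \<Rightarrow> real \<Rightarrow> real) \<Rightarrow> real \<Rightarrow> real \<Rightarrow> real" where
  "goursat_defect \<beta>\<^sub>1 \<beta>\<^sub>2 f X Y =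
     f X Y - f X 0 - f 0 Y + f 0 0
     + \<beta>\<^sub>2 * integral {0..Y} (\<lambda>y. f X y - f 0 y)
     + \<beta>\<^sub>1 * integral {0..X} (\<lambda>x. f x Y - f x 0)"

text \<open>
  Boundary values and equation hold up to an error \<open>\<eta>\<close>. Exact solutions are the case \<open>\<eta> = 0\<close>, so
  that comparing two realizations, a realization with the limit, and two solutions are instances of
  a single statement.
\<close>

definition approx_solution ::
  "real \<Rightarrow> real \<Rightarrow> real \<Rightarrow> real \<Rightarrow> (real \<Rightarrow> real) \<Rightarrow> (real \<Rightarrow> real) \<Rightarrow> real \<Rightarrow> (real \<Rightarrow> real \<Rightarrow> real) \<Rightarrow> bool"
  where
  "approx_solution \<beta>\<^sub>1 \<beta>\<^sub>2 A B u v \<eta> f \<longleftrightarrow>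
     continuous_on ({0..A} \<times> {0..B}) (\<lambda>(x, y). f x y) \<and>
     (\<forall>x\<in>{0..A}. \<bar>f x 0 - u x\<bar> \<le> \<eta>) \<and>
     (\<forall>y\<in>{0..B}. \<bar>f 0 y - v y\<bar> \<le> \<eta>) \<and>
     (\<forall>X\<in>{0..A}. \<forall>Y\<in>{0..B}. \<bar>goursat_defect \<beta>\<^sub>1 \<beta>\<^sub>2 f X Y\<bar> \<le> \<eta>)"

lemma approx_solution_0_iff:
  "approx_solution \<beta>\<^sub>1 \<beta>\<^sub>2 A B u v 0 f \<longleftrightarrow> integrated_pde_solution \<beta>\<^sub>1 \<beta>\<^sub>2 A B u v f"
  by (simp add: approx_solution_def integrated_pde_solution_def goursat_defect_def)

lemma approx_solution_cong:
  assumes "\<And>x y. x \<in> {0..A} \<Longrightarrow> y \<in> {0..B} \<Longrightarrow> f x y = g x y"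
    and "0 \<le> A" "0 \<le> B"
    and f: "approx_solution \<beta>\<^sub>1 \<beta>\<^sub>2 A B u v \<eta> f"
  shows "approx_solution \<beta>\<^sub>1 \<beta>\<^sub>2 A B u v \<eta> g"
proof -
  have "continuous_on ({0..A} \<times> {0..B}) (\<lambda>(x, y). g x y) =
      continuous_on ({0..A} \<times> {0..B}) (\<lambda>(x, y). f x y)"
    using assms(1) by (intro continuous_on_cong) auto
  moreover have "goursat_defect \<beta>\<^sub>1 \<beta>\<^sub>2 g X Y = goursat_defect \<beta>\<^sub>1 \<beta>\<^sub>2 f X Y"
    if "X \<in> {0..A}" "Y \<in> {0..B}" for X Y
    unfolding goursat_defect_def using assms(1)[symmetric] that
    by (intro arg_cong2[where f = "(+)"] arg_cong2[where f = "(-)"] arg_cong2[where f = "(*)"]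
        integral_cong refl) auto
  ultimately show ?thesis
    using f assms(1-3) by (simp add: approx_solution_def)
qed

lemma continuous_on_slices:
  fixes f :: "real \<Rightarrow> real \<Rightarrow> real"
  assumes "continuous_on (S \<times> T) (\<lambda>(x, y). f x y)"
  shows "x \<in> S \<Longrightarrow> continuous_on T (\<lambda>y. f x y)"
    and "y \<in> T \<Longrightarrow> continuous_on S (\<lambda>x. f x y)"
proof -
  show "continuous_on T (\<lambda>y. f x y)" if "x \<in> S"
  proof -
    have "continuous_on T (\<lambda>y. (x, y))" by (intro continuous_intros)
    from continuous_on_compose2[OF assms this] that show ?thesis by auto
  qed
  show "continuous_on S (\<lambda>x. f x y)" if "y \<in> T"
  proof -
    have "continuous_on S (\<lambda>x. (x, y))" by (intro continuous_intros)
    from continuous_on_compose2[OF assms this] that show ?thesis by auto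
  qed
qed

lemma integrable_on_slices:
  fixes f :: "real \<Rightarrow> real \<Rightarrow> real"
  assumes cont: "continuous_on ({0..A} \<times> {0..B}) (\<lambda>(x, y). f x y)"
    and X: "X \<in> {0..A}" and Y: "Y \<in> {0..B}"
  shows "x \<in> {0..A} \<Longrightarrow> (\<lambda>y. f x y) integrable_on {0..Y}"
    and "y \<in> {0..B} \<Longrightarrow> (\<lambda>x. f x y) integrable_on {0..X}"
proof -
  show "(\<lambda>y. f x y) integrable_on {0..Y}" if "x \<in> {0..A}"
    using that Y
    by (intro integrable_continuous_interval continuous_on_subset[OF continuous_on_slices(1)[OF cont]]) auto
  show "(\<lambda>x. f x y) integrable_on {0..X}" if "y \<in> {0..B}"
    using that X
    by (intro integrable_continuous_interval continuous_on_subset[OF continuous_on_slices(2)[OF cont]]) auto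
qed

lemma goursat_defect_diff:
  assumes f: "continuous_on ({0..A} \<times> {0..B}) (\<lambda>(x, y). f x y)"
    and g: "continuous_on ({0..A} \<times> {0..B}) (\<lambda>(x, y). g x y)"
    and X: "X \<in> {0..A}" and Y: "Y \<in> {0..B}"
  shows "goursat_defect \<beta>\<^sub>1 \<beta>\<^sub>2 (\<lambda>x y. f x y - g x y) X Y =
    goursat_defect \<beta>\<^sub>1 \<beta>\<^sub>2 f X Y - goursat_defect \<beta>\<^sub>1 \<beta>\<^sub>2 g X Y"
proof -
  have 0: "0 \<in> {0..A}" "0 \<in> {0..B}" using X Y by auto
  note i = integrable_on_slices(1)[OF f X Y] integrable_on_slices(1)[OF g X Y]
    integrable_on_slices(2)[OF f X Y] integrable_on_slices(2)[OF g X Y]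
  have eq1: "integral {0..Y} (\<lambda>y. (f X y - g X y) - (f 0 y - g 0 y)) =
      integral {0..Y} (\<lambda>y. f X y - f 0 y) - integral {0..Y} (\<lambda>y. g X y - g 0 y)"
    using X Y 0 by (simp add: integral_diff integrable_diff i)
  have eq2: "integral {0..X} (\<lambda>x. (f x Y - g x Y) - (f x 0 - g x 0)) =
      integral {0..X} (\<lambda>x. f x Y - f x 0) - integral {0..X} (\<lambda>x. g x Y - g x 0)"
    using X Y 0 by (simp add: integral_diff integrable_diff i)
  show ?thesis
    unfolding goursat_defect_def eq1 eq2 by (simp add: algebra_simps)
qed

text \<open>
  Continuity of the defect in the uniform norm; it lets the equation pass to uniform limits.
\<close>

lemma abs_goursat_defect_le:
  assumes \<beta>: "0 \<le> \<beta>\<^sub>1" "0 \<le> \<beta>\<^sub>2"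
    and f: "continuous_on ({0..A} \<times> {0..B}) (\<lambda>(x, y). f x y)"
    and X: "X \<in> {0..A}" and Y: "Y \<in> {0..B}"
    and le: "\<And>x y. x \<in> {0..A} \<Longrightarrow> y \<in> {0..B} \<Longrightarrow> \<bar>f x y\<bar> \<le> c"
  shows "\<bar>goursat_defect \<beta>\<^sub>1 \<beta>\<^sub>2 f X Y\<bar> \<le> (4 + 2 * \<beta>\<^sub>1 * A + 2 * \<beta>\<^sub>2 * B) * c"
proof -
  have 0: "0 \<in> {0..A}" "0 \<in> {0..B}" using X Y by auto
  have c: "0 \<le> c" using le[OF X Y] by linarith
  have 1: "\<bar>integral {0..Y} (\<lambda>y. f X y - f 0 y)\<bar> \<le> (2 * c) * (Y - 0)"
  proof -
    have "norm (integral (cbox 0 Y) (\<lambda>y. f X y - f 0 y)) \<le> (2 * c) * measure lborel (cbox 0 Y)"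
    proof (rule integrable_bound)
      show "(\<lambda>y. f X y - f 0 y) integrable_on cbox 0 Y"
        using integrable_on_slices(1)[OF f X Y] X 0 by (auto intro!: integrable_diff)
      show "norm (f X y - f 0 y) \<le> 2 * c" if "y \<in> cbox 0 Y" for y
        using that le[of X y] le[of 0 y] X Y 0 by auto
    qed (use c in auto)
    then show ?thesis using Y by simp
  qed
  have 2: "\<bar>integral {0..X} (\<lambda>x. f x Y - f x 0)\<bar> \<le> (2 * c) * (X - 0)"
  proof -
    have "norm (integral (cbox 0 X) (\<lambda>x. f x Y - f x 0)) \<le> (2 * c) * measure lborel (cbox 0 X)"
    proof (rule integrable_bound)
      show "(\<lambda>x. f x Y - f x 0) integrable_on cbox 0 X"
        using integrable_on_slices(2)[OF f X Y] Y 0 by (auto intro!: integrable_diff)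
      show "norm (f x Y - f x 0) \<le> 2 * c" if "x \<in> cbox 0 X" for x
        using that le[of x Y] le[of x 0] X Y 0 by auto
    qed (use c in auto)
    then show ?thesis using X by simp
  qed
  have "\<bar>\<beta>\<^sub>2 * integral {0..Y} (\<lambda>y. f X y - f 0 y)\<bar> \<le> \<beta>\<^sub>2 * ((2 * c) * B)"
  proof -
    have "2 * c * (Y - 0) \<le> 2 * c * B" using c Y by (intro mult_left_mono) auto
    then show ?thesis
      unfolding abs_mult using \<beta> 1 by (intro mult_mono) linarith+
  qed
  moreover have "\<bar>\<beta>\<^sub>1 * integral {0..X} (\<lambda>x. f x Y - f x 0)\<bar> \<le> \<beta>\<^sub>1 * ((2 * c) * A)"
  proof -
    have "2 * c * (X - 0) \<le> 2 * c * A" using c X by (intro mult_left_mono) auto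
    then show ?thesis
      unfolding abs_mult using \<beta> 2 by (intro mult_mono) linarith+
  qed
  ultimately show ?thesis
    using le[OF X Y] le[OF X 0(2)] le[OF 0(1) Y] le[OF 0]
    unfolding goursat_defect_def by (simp add: algebra_simps)
qed

lemma integral_exp_linear:
  fixes K :: real
  assumes "K > 0" "0 \<le> Y"
  shows "((\<lambda>y. exp (K * (X + y))) has_integral (exp (K * (X + Y)) / K - exp (K * X) / K)) {0..Y}"
proof -
  have "((\<lambda>y. exp (K * (X + y))) has_integral
      (exp (K * (X + Y)) / K - exp (K * (X + 0)) / K)) {0..Y}"
    using assms
    by (intro fundamental_theorem_of_calculus)
      (auto intro!: derivative_eq_intros simp flip: has_real_derivative_iff_has_vector_derivative)
  then show ?thesis by simp
qed

text \<open>
  The weight \<open>exp (- K (x + y))\<close> makes each of the two integrals contribute at most \<open>1 / K\<close> times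
  its coefficient. At a maximum point of the weighted function, \<open>K = 2 (\<beta>\<^sub>1 + \<beta>\<^sub>2)\<close> lets half
  of the left-hand side absorb them both.
\<close>

lemma two_variable_gronwall:
  fixes u :: "real \<Rightarrow> real \<Rightarrow> real"
  assumes \<beta>: "0 < \<beta>\<^sub>1" "0 < \<beta>\<^sub>2"
    and u: "continuous_on ({0..A} \<times> {0..B}) (\<lambda>(x, y). u x y)"
    and le: "\<And>X Y. X \<in> {0..A} \<Longrightarrow> Y \<in> {0..B} \<Longrightarrow>
      \<bar>u X Y\<bar> \<le> \<epsilon> + \<beta>\<^sub>2 * integral {0..Y} (\<lambda>y. \<bar>u X y\<bar>) + \<beta>\<^sub>1 * integral {0..X} (\<lambda>x. \<bar>u x Y\<bar>)"
    and X: "X \<in> {0..A}" and Y: "Y \<in> {0..B}"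
  shows "\<bar>u X Y\<bar> \<le> 2 * exp (2 * (\<beta>\<^sub>1 + \<beta>\<^sub>2) * (A + B)) * \<epsilon>"
proof -
  define K where "K = 2 * (\<beta>\<^sub>1 + \<beta>\<^sub>2)"
  have K: "K > 0" using \<beta> by (simp add: K_def)
  have ua: "continuous_on ({0..A} \<times> {0..B}) (\<lambda>(x, y). \<bar>u x y\<bar>)"
    using continuous_on_rabs[OF u] by (simp add: case_prod_unfold)
  define w where "w = (\<lambda>(x, y). \<bar>u x y\<bar> * exp (- K * (x + y)))"
  have "continuous_on ({0..A} \<times> {0..B}) w"
    unfolding w_def case_prod_unfold
    by (intro continuous_on_mult[OF ua[unfolded case_prod_unfold]] continuous_intros)
  then obtain X0 Y0 where 0: "X0 \<in> {0..A}" "Y0 \<in> {0..B}"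
    and max: "\<And>x y. x \<in> {0..A} \<Longrightarrow> y \<in> {0..B} \<Longrightarrow> w (x, y) \<le> w (X0, Y0)"
    using continuous_attains_sup[of "{0..A} \<times> {0..B}" w] X Y
    by (auto simp: compact_Times)
  define m where "m = w (X0, Y0)"
  have m0: "0 \<le> m" by (simp add: m_def w_def)
  have u_w: "\<bar>u x y\<bar> = w (x, y) * exp (K * (x + y))" for x y
    by (simp add: w_def mult.assoc flip: exp_add)
  have u_le: "\<bar>u x y\<bar> \<le> m * exp (K * (x + y))" if "x \<in> {0..A}" "y \<in> {0..B}" for x y
    using mult_right_mono[OF max[OF that], of "exp (K * (x + y))"] by (simp add: u_w m_def)
  have u_eq: "\<bar>u X0 Y0\<bar> = m * exp (K * (X0 + Y0))"
    by (simp add: u_w m_def)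
  have "integral {0..Y0} (\<lambda>y. \<bar>u X0 y\<bar>) \<le> m * (exp (K * (X0 + Y0)) / K - exp (K * X0) / K)"
    using integral_exp_linear[OF K, of Y0 X0] 0 integrable_on_slices(1)[OF ua 0]
    by (intro has_integral_le[OF integrable_integral has_integral_mult_right])
       (auto intro: u_le)
  also have "\<dots> \<le> m * (exp (K * (X0 + Y0)) / K)"
    using K m0 by (intro mult_left_mono) auto
  finally have 1: "integral {0..Y0} (\<lambda>y. \<bar>u X0 y\<bar>) \<le> m * (exp (K * (X0 + Y0)) / K)" .
  have "integral {0..X0} (\<lambda>x. \<bar>u x Y0\<bar>) \<le> m * (exp (K * (Y0 + X0)) / K - exp (K * Y0) / K)"
    using integral_exp_linear[OF K, of X0 Y0] 0 integrable_on_slices(2)[OF ua 0] u_le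
    by (intro has_integral_le[OF integrable_integral has_integral_mult_right])
       (auto simp: add.commute)
  also have "\<dots> \<le> m * (exp (K * (X0 + Y0)) / K)"
    using K m0 by (intro mult_left_mono) (auto simp: add.commute)
  finally have 2: "integral {0..X0} (\<lambda>x. \<bar>u x Y0\<bar>) \<le> m * (exp (K * (X0 + Y0)) / K)" .
  have "m * exp (K * (X0 + Y0)) \<le> \<epsilon> + \<beta>\<^sub>2 * (m * (exp (K * (X0 + Y0)) / K)) + \<beta>\<^sub>1 * (m * (exp (K * (X0 + Y0)) / K))"
    using le[OF 0] \<beta> 1 2 unfolding u_eq
    by (smt (verit, best) mult_left_mono)
  also have "\<dots> = \<epsilon> + (\<beta>\<^sub>1 + \<beta>\<^sub>2) / K * (m * exp (K * (X0 + Y0)))"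
    by (simp add: add_divide_distrib ring_distribs)
  also have "(\<beta>\<^sub>1 + \<beta>\<^sub>2) / K = 1 / 2" using K by (simp add: K_def)
  finally have 3: "m * exp (K * (X0 + Y0)) \<le> 2 * \<epsilon>" by simp
  have "m \<le> m * exp (K * (X0 + Y0))"
    using m0 K 0 by (simp add: mult_le_cancel_left1)
  with 3 have "m \<le> 2 * \<epsilon>" by simp
  have "\<bar>u X Y\<bar> \<le> m * exp (K * (X + Y))" by (rule u_le[OF X Y])
  also have "\<dots> \<le> (2 * \<epsilon>) * exp (K * (A + B))"
    using \<open>m \<le> 2 * \<epsilon>\<close> m0 K X Y by (intro mult_mono) auto
  finally show ?thesis by (simp add: K_def ac_simps)
qed

definition stability_const :: "real \<Rightarrow> real \<Rightarrow> real \<Rightarrow> real \<Rightarrow> real" where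
  "stability_const \<beta>\<^sub>1 \<beta>\<^sub>2 A B = 2 * exp (2 * (\<beta>\<^sub>1 + \<beta>\<^sub>2) * (A + B)) * (4 + \<beta>\<^sub>1 * A + \<beta>\<^sub>2 * B)"

lemma stability_const_pos:
  assumes "0 < \<beta>\<^sub>1" "0 < \<beta>\<^sub>2" "0 \<le> A" "0 \<le> B"
  shows "0 < stability_const \<beta>\<^sub>1 \<beta>\<^sub>2 A B"
proof -
  have "0 < 4 + \<beta>\<^sub>1 * A + \<beta>\<^sub>2 * B"
    using assms by (intro add_pos_nonneg) auto
  then show ?thesis by (simp add: stability_const_def)
qed

text \<open>
  The defect is linear, so the difference of the two functions has small defect and small boundary
  values. Solving the defect for the value at \<open>(X, Y)\<close> bounds it by those and by integrals of the
  difference, as in \<open>two_variable_gronwall\<close>.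
\<close>

lemma approx_solution_stability:
  assumes \<beta>: "0 < \<beta>\<^sub>1" "0 < \<beta>\<^sub>2"
    and f: "approx_solution \<beta>\<^sub>1 \<beta>\<^sub>2 A B u v \<eta> f"
    and g: "approx_solution \<beta>\<^sub>1 \<beta>\<^sub>2 A B u v \<theta> g"
    and X: "X \<in> {0..A}" and Y: "Y \<in> {0..B}"
  shows "\<bar>f X Y - g X Y\<bar> \<le> stability_const \<beta>\<^sub>1 \<beta>\<^sub>2 A B * (\<eta> + \<theta>)"
proof -
  define d where "d = (\<lambda>x y. f x y - g x y)"
  define \<delta> where "\<delta> = \<eta> + \<theta>"
  have 0: "0 \<in> {0..A}" "0 \<in> {0..B}" using X Y by auto
  have fc: "continuous_on ({0..A} \<times> {0..B}) (\<lambda>(x, y). f x y)"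
    and gc: "continuous_on ({0..A} \<times> {0..B}) (\<lambda>(x, y). g x y)"
    using f g by (auto simp: approx_solution_def)
  have dc: "continuous_on ({0..A} \<times> {0..B}) (\<lambda>(x, y). d x y)"
    using continuous_on_diff[OF fc gc] by (simp add: d_def case_prod_unfold)
  then have dac: "continuous_on ({0..A} \<times> {0..B}) (\<lambda>(x, y). \<bar>d x y\<bar>)"
    using continuous_on_rabs[OF dc] by (simp add: case_prod_unfold)
  have dx: "\<bar>d x 0\<bar> \<le> \<delta>" if "x \<in> {0..A}" for x
  proof -
    have "\<bar>f x 0 - u x\<bar> \<le> \<eta>" "\<bar>g x 0 - u x\<bar> \<le> \<theta>"
      using f g that by (auto simp: approx_solution_def)
    then show ?thesis unfolding d_def \<delta>_def by linarith
  qed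
  have dy: "\<bar>d 0 y\<bar> \<le> \<delta>" if "y \<in> {0..B}" for y
  proof -
    have "\<bar>f 0 y - v y\<bar> \<le> \<eta>" "\<bar>g 0 y - v y\<bar> \<le> \<theta>"
      using f g that by (auto simp: approx_solution_def)
    then show ?thesis unfolding d_def \<delta>_def by linarith
  qed
  have \<delta>0: "0 \<le> \<delta>" using dx[OF 0(1)] by linarith
  have dd: "\<bar>goursat_defect \<beta>\<^sub>1 \<beta>\<^sub>2 d x y\<bar> \<le> \<delta>" if "x \<in> {0..A}" "y \<in> {0..B}" for x y
  proof -
    have "\<bar>goursat_defect \<beta>\<^sub>1 \<beta>\<^sub>2 f x y\<bar> \<le> \<eta>" "\<bar>goursat_defect \<beta>\<^sub>1 \<beta>\<^sub>2 g x y\<bar> \<le> \<theta>"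
      using f g that by (auto simp: approx_solution_def)
    then show ?thesis
      unfolding d_def \<delta>_def goursat_defect_diff[OF fc gc that] by linarith
  qed
  have "\<bar>d X Y\<bar> \<le> 2 * exp (2 * (\<beta>\<^sub>1 + \<beta>\<^sub>2) * (A + B)) * ((4 + \<beta>\<^sub>1 * A + \<beta>\<^sub>2 * B) * \<delta>)"
  proof (rule two_variable_gronwall[OF \<beta> dc _ X Y])
    fix x y assume xy: "x \<in> {0..A}" "y \<in> {0..B}"
    note ints = integrable_on_slices[OF dc xy] integrable_on_slices[OF dac xy]
    have "\<bar>integral {0..y} (\<lambda>t. d x t - d 0 t)\<bar> \<le> integral {0..y} (\<lambda>t. \<bar>d x t\<bar> + \<delta>)"
      unfolding real_norm_def[symmetric] using xy 0
    proof (intro integral_norm_bound_integral)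
      show "norm (d x t - d 0 t) \<le> norm (d x t) + \<delta>" if "t \<in> {0..y}" for t
        using dy[of t] that xy by auto
    qed (use ints in \<open>auto intro!: integrable_diff integrable_add\<close>)
    also have "\<dots> = integral {0..y} (\<lambda>t. \<bar>d x t\<bar>) + \<delta> * y"
      using ints xy by (subst integral_add) auto
    finally have 1: "\<bar>integral {0..y} (\<lambda>t. d x t - d 0 t)\<bar> \<le> integral {0..y} (\<lambda>t. \<bar>d x t\<bar>) + \<delta> * B"
      using xy \<delta>0 by (smt (verit) atLeastAtMost_iff mult_left_mono)
    have "\<bar>integral {0..x} (\<lambda>s. d s y - d s 0)\<bar> \<le> integral {0..x} (\<lambda>s. \<bar>d s y\<bar> + \<delta>)"
      unfolding real_norm_def[symmetric] using xy 0
    proof (intro integral_norm_bound_integral)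
      show "norm (d s y - d s 0) \<le> norm (d s y) + \<delta>" if "s \<in> {0..x}" for s
        using dx[of s] that xy by auto
    qed (use ints in \<open>auto intro!: integrable_diff integrable_add\<close>)
    also have "\<dots> = integral {0..x} (\<lambda>s. \<bar>d s y\<bar>) + \<delta> * x"
      using ints xy by (subst integral_add) auto
    finally have 2: "\<bar>integral {0..x} (\<lambda>s. d s y - d s 0)\<bar> \<le> integral {0..x} (\<lambda>s. \<bar>d s y\<bar>) + \<delta> * A"
      using xy \<delta>0 by (smt (verit) atLeastAtMost_iff mult_left_mono)
    have 3: "\<bar>\<beta>\<^sub>2 * integral {0..y} (\<lambda>t. d x t - d 0 t)\<bar> \<le> \<beta>\<^sub>2 * (integral {0..y} (\<lambda>t. \<bar>d x t\<bar>) + \<delta> * B)"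
      using 1 \<beta> by (simp add: abs_mult)
    have 4: "\<bar>\<beta>\<^sub>1 * integral {0..x} (\<lambda>s. d s y - d s 0)\<bar> \<le> \<beta>\<^sub>1 * (integral {0..x} (\<lambda>s. \<bar>d s y\<bar>) + \<delta> * A)"
      using 2 \<beta> by (simp add: abs_mult)
    have "\<bar>d x y\<bar> \<le> 4 * \<delta> + \<beta>\<^sub>2 * (integral {0..y} (\<lambda>t. \<bar>d x t\<bar>) + \<delta> * B)
        + \<beta>\<^sub>1 * (integral {0..x} (\<lambda>s. \<bar>d s y\<bar>) + \<delta> * A)"
      using dd[OF xy] dx[OF xy(1)] dy[OF xy(2)] dx[OF 0(1)] 3 4
      unfolding goursat_defect_def by linarith
    then show "\<bar>d x y\<bar> \<le> (4 + \<beta>\<^sub>1 * A + \<beta>\<^sub>2 * B) * \<delta> + \<beta>\<^sub>2 * integral {0..y} (\<lambda>t. \<bar>d x t\<bar>)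
        + \<beta>\<^sub>1 * integral {0..x} (\<lambda>s. \<bar>d s y\<bar>)"
      by (simp add: algebra_simps)
  qed
  then show ?thesis by (simp add: d_def \<delta>_def stability_const_def ac_simps)
qed

text \<open>
  Stability makes approximate solutions with errors \<open>1 / (n + 1)\<close> uniformly Cauchy. The lower bound \<open>c\<close> is
  carried along to make the limit positive.
\<close>

lemma solution_if_approx_solutions:
  assumes \<beta>: "0 < \<beta>\<^sub>1" "0 < \<beta>\<^sub>2" and AB: "0 \<le> A" "0 \<le> B"
    and approx: "\<And>\<eta>. \<eta> > 0 \<Longrightarrow> \<exists>g. approx_solution \<beta>\<^sub>1 \<beta>\<^sub>2 A B u v \<eta> g \<and>
      (\<forall>x\<in>{0..A}. \<forall>y\<in>{0..B}. c \<le> g x y)"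
  obtains f where "approx_solution \<beta>\<^sub>1 \<beta>\<^sub>2 A B u v 0 f"
    and "\<And>x y. x \<in> {0..A} \<Longrightarrow> y \<in> {0..B} \<Longrightarrow> c \<le> f x y"
proof -
  define R where "R = {0..A} \<times> {0..B}"
  define C where "C = stability_const \<beta>\<^sub>1 \<beta>\<^sub>2 A B"
  have C: "C > 0" using \<beta> AB stability_const_pos by (simp add: C_def)
  obtain g where g: "\<And>n. approx_solution \<beta>\<^sub>1 \<beta>\<^sub>2 A B u v (inverse (real (Suc n))) (g n)"
    and gc: "\<And>n x y. x \<in> {0..A} \<Longrightarrow> y \<in> {0..B} \<Longrightarrow> c \<le> g n x y"
    using approx[of "inverse (real (Suc n))" for n] by (metis inverse_positive_iff_positive of_nat_0_less_iff zero_less_Suc)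
  have small: "\<exists>N. \<forall>n\<ge>N. K * inverse (real (Suc n)) < e" if "e > 0" for e K :: real
  proof -
    have "(\<lambda>n. K * inverse (real (Suc n))) \<longlonglongrightarrow> K * 0"
      by (intro tendsto_intros LIMSEQ_inverse_real_of_nat)
    then have "eventually (\<lambda>n. K * inverse (real (Suc n)) < e) sequentially"
      using that by (auto intro: order_tendstoD)
    then show ?thesis by (simp add: eventually_sequentially)
  qed
  have "uniformly_convergent_on R (\<lambda>n (x, y). g n x y)"
  proof (rule Cauchy_uniformly_convergent, rule uniformly_Cauchy_onI)
    fix e :: real assume "e > 0"
    then obtain N where N: "\<And>n. n \<ge> N \<Longrightarrow> C * inverse (real (Suc n)) < e / 2"
      using small[of "e/2" C] by auto
    have "dist (g m x y) (g n x y) < e" if "m \<ge> N" "n \<ge> N" "x \<in> {0..A}" "y \<in> {0..B}" for m n x y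
    proof -
      have "\<bar>g m x y - g n x y\<bar> \<le> C * (inverse (real (Suc m)) + inverse (real (Suc n)))"
        using approx_solution_stability[OF \<beta> g g that(3,4)] by (simp add: C_def)
      also have "\<dots> < e"
        using N[OF that(1)] N[OF that(2)] by (simp add: distrib_left)
      finally show ?thesis by (simp add: dist_real_def)
    qed
    then show "\<exists>M. \<forall>x\<in>R. \<forall>m\<ge>M. \<forall>n\<ge>M. dist (case x of (x, y) \<Rightarrow> g m x y) (case x of (x, y) \<Rightarrow> g n x y) < e"
      unfolding R_def by (intro exI[of _ N]) auto
  qed
  then obtain f' where lim: "uniform_limit R (\<lambda>n (x, y). g n x y) f' sequentially"
    by (auto simp: uniformly_convergent_on_def)
  define f where "f = curry f'"
  have f': "f' = (\<lambda>(x, y). f x y)" by (simp add: f_def)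
  have near: "\<exists>n\<ge>N. \<forall>x\<in>{0..A}. \<forall>y\<in>{0..B}. \<bar>g n x y - f x y\<bar> < e" if "e > 0" for e and N :: nat
  proof -
    have "eventually (\<lambda>n. \<forall>p\<in>R. dist (case p of (x, y) \<Rightarrow> g n x y) (f' p) < e) sequentially"
      using uniform_limitD[OF lim that] .
    then obtain n0 where "\<And>n. n \<ge> n0 \<Longrightarrow> \<forall>p\<in>R. dist (case p of (x, y) \<Rightarrow> g n x y) (f' p) < e"
      by (auto simp: eventually_sequentially)
    from this[of "max n0 N"] show ?thesis
      by (intro exI[of _ "max n0 N"]) (auto simp: R_def f' dist_real_def)
  qed
  have fc: "continuous_on ({0..A} \<times> {0..B}) (\<lambda>(x, y). f x y)"
    using uniform_limit_theorem[OF _ lim] g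
    by (auto simp: R_def f' approx_solution_def)
  \<comment> \<open>Every closed condition on the limit is checked with the same two-parameter estimate.\<close>
  have bound: "P \<le> 0" if "\<And>n e. \<lbrakk>e > 0; \<And>x y. x \<in> {0..A} \<Longrightarrow> y \<in> {0..B} \<Longrightarrow> \<bar>g n x y - f x y\<bar> \<le> e\<rbrakk> \<Longrightarrow>
      P \<le> K * e + inverse (real (Suc n))" for P K :: real
  proof (rule ccontr)
    assume "\<not> P \<le> 0"
    define e where "e = P / (4 * (\<bar>K\<bar> + 1))"
    have e: "e > 0" using \<open>\<not> P \<le> 0\<close> by (auto simp: e_def)
    obtain N where N: "\<And>n. n \<ge> N \<Longrightarrow> inverse (real (Suc n)) < P / 4"
      using small[of "P/4" 1] \<open>\<not> P \<le> 0\<close> by auto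
    obtain n where n: "n \<ge> N" "\<And>x y. x \<in> {0..A} \<Longrightarrow> y \<in> {0..B} \<Longrightarrow> \<bar>g n x y - f x y\<bar> < e"
      using near[OF e, of N] by auto
    have "P \<le> K * e + inverse (real (Suc n))"
      using n by (intro that[OF e]) (auto intro: less_imp_le)
    moreover have "K * e \<le> (\<bar>K\<bar> + 1) * e" using e by (intro mult_right_mono) auto
    moreover have "(\<bar>K\<bar> + 1) * e = P / 4" by (simp add: e_def field_simps)
    ultimately show False using N[OF n(1)] \<open>\<not> P \<le> 0\<close> by linarith
  qed
  have "c \<le> f x y" if "x \<in> {0..A}" "y \<in> {0..B}" for x y
  proof -
    have "c - f x y \<le> 0"
    proof (rule bound[where K = 1])
      fix n e assume "\<And>x y. x \<in> {0..A} \<Longrightarrow> y \<in> {0..B} \<Longrightarrow> \<bar>g n x y - f x y\<bar> \<le> e"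
      from this[OF that] gc[OF that, of n] show "c - f x y \<le> 1 * e + inverse (real (Suc n))"
        by (smt (verit, best) inverse_nonnegative_iff_nonnegative of_nat_0_le_iff)
    qed
    then show ?thesis by simp
  qed
  moreover have "approx_solution \<beta>\<^sub>1 \<beta>\<^sub>2 A B u v 0 f"
    unfolding approx_solution_def
  proof (intro conjI ballI fc)
    fix x assume x: "x \<in> {0..A}"
    show "\<bar>f x 0 - u x\<bar> \<le> 0"
    proof (rule bound[where K = 1])
      fix n e assume "\<And>x y. x \<in> {0..A} \<Longrightarrow> y \<in> {0..B} \<Longrightarrow> \<bar>g n x y - f x y\<bar> \<le> e"
      from this[OF x, of 0] AB have "\<bar>g n x 0 - f x 0\<bar> \<le> e" by simp
      moreover have "\<bar>g n x 0 - u x\<bar> \<le> inverse (real (Suc n))"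
        using g[of n] x by (auto simp: approx_solution_def)
      ultimately show "\<bar>f x 0 - u x\<bar> \<le> 1 * e + inverse (real (Suc n))" by linarith
    qed
  next
    fix y assume y: "y \<in> {0..B}"
    show "\<bar>f 0 y - v y\<bar> \<le> 0"
    proof (rule bound[where K = 1])
      fix n e assume "\<And>x y. x \<in> {0..A} \<Longrightarrow> y \<in> {0..B} \<Longrightarrow> \<bar>g n x y - f x y\<bar> \<le> e"
      from this[OF _ y, of 0] AB have "\<bar>g n 0 y - f 0 y\<bar> \<le> e" by simp
      moreover have "\<bar>g n 0 y - v y\<bar> \<le> inverse (real (Suc n))"
        using g[of n] y by (auto simp: approx_solution_def)
      ultimately show "\<bar>f 0 y - v y\<bar> \<le> 1 * e + inverse (real (Suc n))" by linarith
    qed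
  next
    fix X Y assume XY: "X \<in> {0..A}" "Y \<in> {0..B}"
    show "\<bar>goursat_defect \<beta>\<^sub>1 \<beta>\<^sub>2 f X Y\<bar> \<le> 0"
    proof (rule bound[where K = "4 + 2 * \<beta>\<^sub>1 * A + 2 * \<beta>\<^sub>2 * B"])
      fix n e assume e: "\<And>x y. x \<in> {0..A} \<Longrightarrow> y \<in> {0..B} \<Longrightarrow> \<bar>g n x y - f x y\<bar> \<le> e"
      have gn: "continuous_on ({0..A} \<times> {0..B}) (\<lambda>(x, y). g n x y)"
        "\<bar>goursat_defect \<beta>\<^sub>1 \<beta>\<^sub>2 (g n) X Y\<bar> \<le> inverse (real (Suc n))"
        using g[of n] XY by (auto simp: approx_solution_def)
      have "continuous_on ({0..A} \<times> {0..B}) (\<lambda>(x, y). g n x y - f x y)"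
        using continuous_on_diff[OF gn(1) fc] by (simp add: case_prod_unfold)
      then have "\<bar>goursat_defect \<beta>\<^sub>1 \<beta>\<^sub>2 (\<lambda>x y. g n x y - f x y) X Y\<bar> \<le> (4 + 2 * \<beta>\<^sub>1 * A + 2 * \<beta>\<^sub>2 * B) * e"
        using \<beta> XY e by (intro abs_goursat_defect_le) auto
      then show "\<bar>goursat_defect \<beta>\<^sub>1 \<beta>\<^sub>2 f X Y\<bar> \<le> (4 + 2 * \<beta>\<^sub>1 * A + 2 * \<beta>\<^sub>2 * B) * e + inverse (real (Suc n))"
        using gn(2) unfolding goursat_defect_diff[OF gn(1) fc XY] by linarith
    qed
  qed
  ultimately show thesis using that by blast
qed

section \<open>Functions of finitely many coins\<close>

text \<open>
  All quantities at a finite scale depend on finitely many coins. Since a coin has finitely many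
  values, this alone yields measurability, boundedness and integrability, also for expressions such
  as suprema over a rectangle or integrals over a segment.
\<close>

definition determined_by :: "'i set \<Rightarrow> (('i \<Rightarrow> 'c) \<Rightarrow> 'd) \<Rightarrow> bool" where
  "determined_by S f \<longleftrightarrow> (\<forall>\<omega> \<omega>'. (\<forall>s\<in>S. \<omega> s = \<omega>' s) \<longrightarrow> f \<omega> = f \<omega>')"

lemma space_six_vertex_space [simp]: "space (six_vertex_space b q) = UNIV"
  by (simp add: six_vertex_space_def space_PiM)

lemma sets_six_vertex_space_cong:
  "sets (six_vertex_space b q) = sets (\<Pi>\<^sub>M v\<in>UNIV. count_space UNIV)"
  unfolding six_vertex_space_def by (intro sets_PiM_cong) auto

lemma prob_space_six_vertex_space: "prob_space (six_vertex_space b q)"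
  unfolding six_vertex_space_def by (intro prob_space_PiM measure_pmf.prob_space_axioms)

lemma measurable_coin [measurable]:
  "(\<lambda>\<omega>. \<omega> v) \<in> six_vertex_space b q \<rightarrow>\<^sub>M count_space UNIV"
proof -
  have "(\<lambda>\<omega>. \<omega> v) \<in> (\<Pi>\<^sub>M v\<in>UNIV. count_space UNIV) \<rightarrow>\<^sub>M count_space UNIV"
    by (intro measurable_component_singleton) auto
  then show ?thesis
    using measurable_cong_sets[OF sets_six_vertex_space_cong refl] by blast
qed

lemma determined_by_fun_upd:
  assumes "determined_by (insert s S) f"
  shows "determined_by S (\<lambda>\<omega>. f (fun_upd \<omega> s c))"
  using assms unfolding determined_by_def by (metis fun_upd_apply insert_iff)

lemma
  fixes f :: "(nat \<times> nat \<Rightarrow> bool \<times> bool) \<Rightarrow> real"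
  assumes "finite S" "determined_by S f"
  shows measurable_determined_by: "f \<in> borel_measurable (six_vertex_space b q)"
    and bounded_determined_by: "\<exists>K. \<forall>\<omega>. \<bar>f \<omega>\<bar> \<le> K"
proof -
  have "f \<in> borel_measurable (six_vertex_space b q) \<and> (\<exists>K. \<forall>\<omega>. \<bar>f \<omega>\<bar> \<le> K)"
    using assms
  proof (induction S arbitrary: f rule: finite_induct)
    case empty
    then have "f = (\<lambda>\<omega>. f undefined)" by (auto simp: determined_by_def)
    moreover have "(\<lambda>\<omega>. f undefined) \<in> borel_measurable (six_vertex_space b q)" by simp
    ultimately show ?case by (metis order_refl)
  next
    case (insert s S)
    note IH = insert.IH[OF determined_by_fun_upd[OF insert.prems]]
    \<comment> \<open>Conditioning on the coin at \<open>s\<close> leaves functions of the coins in \<open>S\<close>.\<close>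
    have split: "f \<omega> = (\<Sum>c\<in>UNIV. if \<omega> s = c then f (fun_upd \<omega> s c) else 0)" for \<omega>
      by (simp add: sum.delta)
    have "(\<lambda>\<omega>. \<Sum>c\<in>UNIV. if \<omega> s = c then f (fun_upd \<omega> s c) else 0)
        \<in> borel_measurable (six_vertex_space b q)"
    proof (intro borel_measurable_sum measurable_If)
      fix c :: "bool \<times> bool"
      show "(\<lambda>\<omega>. f (fun_upd \<omega> s c)) \<in> borel_measurable (six_vertex_space b q)"
        using IH by blast
      show "{\<omega> \<in> space (six_vertex_space b q). \<omega> s = c} \<in> sets (six_vertex_space b q)"
        using measurable_sets[OF measurable_coin, of "{c}"] by (simp add: vimage_def)
    qed simp
    then have "f \<in> borel_measurable (six_vertex_space b q)"
      by (simp flip: split)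
    moreover obtain K where K: "\<And>c \<omega>. \<bar>f (fun_upd \<omega> s c)\<bar> \<le> K c"
      using IH by metis
    have "\<bar>f \<omega>\<bar> \<le> (\<Sum>c\<in>UNIV. K c)" for \<omega>
    proof -
      have "0 \<le> K c" for c using K[of \<omega> c] by linarith
      then have "K (\<omega> s) \<le> (\<Sum>c\<in>UNIV. K c)" by (intro member_le_sum) auto
      with K[of \<omega> "\<omega> s"] show ?thesis by simp
    qed
    ultimately show ?case by blast
  qed
  then show "f \<in> borel_measurable (six_vertex_space b q)" "\<exists>K. \<forall>\<omega>. \<bar>f \<omega>\<bar> \<le> K"
    by auto
qed

lemma integrable_determined_by:
  fixes f :: "(nat \<times> nat \<Rightarrow> bool \<times> bool) \<Rightarrow> real"
  assumes "finite S" "determined_by S f"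
  shows "integrable (six_vertex_space b q) f"
proof -
  interpret prob_space "six_vertex_space b q" by (rule prob_space_six_vertex_space)
  obtain K where "\<And>\<omega>. \<bar>f \<omega>\<bar> \<le> K" using bounded_determined_by[OF assms] by blast
  then show ?thesis
    using measurable_determined_by[OF assms]
    by (intro integrable_const_bound[where B = K]) auto
qed

text \<open>
  Replacing one coin by an independent copy preserves the product measure. This is how the
  randomness of a single vertex is integrated out with all other coins held fixed.
\<close>

lemma integral_resample_coin:
  fixes f :: "(nat \<times> nat \<Rightarrow> bool \<times> bool) \<Rightarrow> real"
  assumes "finite S" "determined_by S f"
  shows "(\<integral>\<omega>. f \<omega> \<partial>six_vertex_space b q) =
    (\<integral>\<omega>. (\<integral>c. f (fun_upd \<omega> v c) \<partial>vertex_coins b q) \<partial>six_vertex_space b q)"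
proof -
  let ?P = "six_vertex_space b q" and ?C = "measure_pmf (vertex_coins b q)"
  interpret P: prob_space ?P by (rule prob_space_six_vertex_space)
  interpret PC: pair_prob_space ?C ?P ..
  let ?T = "\<lambda>(c, \<omega>). fun_upd \<omega> v c"
  have T: "distr (?C \<Otimes>\<^sub>M ?P) ?P ?T = ?P"
    using distr_pair_PiM_eq_PiM[of UNIV "\<lambda>_. ?C" v]
    by (simp add: six_vertex_space_def measure_pmf.prob_space_axioms)
  have meas_T: "?T \<in> (?C \<Otimes>\<^sub>M ?P) \<rightarrow>\<^sub>M ?P"
    unfolding six_vertex_space_def case_prod_unfold
    by (intro measurable_fun_upd[where J = UNIV] measurable_fst measurable_snd) auto
  have f: "f \<in> borel_measurable ?P" by (rule measurable_determined_by[OF assms])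
  obtain K where K: "\<And>\<omega>. \<bar>f \<omega>\<bar> \<le> K" using bounded_determined_by[OF assms] by blast
  have int: "integrable (?C \<Otimes>\<^sub>M ?P) (\<lambda>p. f (?T p))"
    using K measurable_compose[OF meas_T f]
    by (intro PC.P.integrable_const_bound[where B = K]) auto
  have "(\<integral>\<omega>. f \<omega> \<partial>?P) = (\<integral>p. f (?T p) \<partial>(?C \<Otimes>\<^sub>M ?P))"
    using integral_distr[OF meas_T f] T by simp
  also have "\<dots> = (\<integral>\<omega>. (\<integral>c. f (fun_upd \<omega> v c) \<partial>?C) \<partial>?P)"
    using PC.integral_snd[of "\<lambda>c \<omega>. f (fun_upd \<omega> v c)"] int by (simp add: case_prod_unfold)
  finally show ?thesis .
qed

section \<open>The height function\<close>

lemma outgoing_determined: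
  assumes "\<And>i j. 1 \<le> i \<Longrightarrow> i \<le> x \<Longrightarrow> j \<le> y \<Longrightarrow> \<omega> (i, j) = \<omega>' (i, j)"
  shows "outgoing lft btm \<omega> x y = outgoing lft btm \<omega>' x y"
  using assms
  by (induction lft btm \<omega> x y rule: outgoing.induct) simp_all

lemma height_determined:
  assumes "\<And>i j. i \<le> x \<Longrightarrow> j \<le> y \<Longrightarrow> \<omega> (i, j) = \<omega>' (i, j)"
  shows "height lft btm \<omega> x y = height lft btm \<omega>' x y"
  using assms
proof (induction y)
  case 0
  then show ?case using height_axes_deterministic(1) by blast
next
  case (Suc y)
  then have "height lft btm \<omega> x y = height lft btm \<omega>' x y"
    "outgoing lft btm \<omega> x (Suc y) = outgoing lft btm \<omega>' x (Suc y)"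
    by (auto intro!: outgoing_determined)
  then show ?case by simp
qed

text \<open>
  Piecewise linear interpolation of a sequence. Both steps by which the height is extended to
  real arguments have this form, so each continuity property is proved once for the two directions.
\<close>

definition interp :: "(nat \<Rightarrow> real) \<Rightarrow> real \<Rightarrow> real" where
  "interp a x = (1 - frac x) * a (nat \<lfloor>x\<rfloor>) + frac x * a (nat \<lfloor>x\<rfloor> + 1)"

lemma height_x_eq: "height_x lft btm \<omega> x n = interp (\<lambda>i. of_int (height lft btm \<omega> i n)) x"
  by (simp add: height_x_def interp_def)

lemma height_xy_eq: "height_xy lft btm \<omega> x y = interp (\<lambda>n. height_x lft btm \<omega> x n) y"
  by (simp add: height_xy_def interp_def)

lemma interp_of_nat [simp]: "interp a (real n) = a n"
  by (simp add: interp_def frac_def)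

text \<open>
  The formula holds on closed cells. At the right end the floor jumps to the next cell, where the
  interpolation agrees.
\<close>

lemma interp_affine:
  assumes "real n \<le> x" "x \<le> real n + 1"
  shows "interp a x = a n + (x - real n) * (a (Suc n) - a n)"
proof (cases "x = real n + 1")
  case True
  then show ?thesis using interp_of_nat[of a "Suc n"] by (simp add: add.commute)
next
  case False
  then have "\<lfloor>x\<rfloor> = int n" using assms by linarith
  then show ?thesis by (simp add: interp_def frac_def algebra_simps)
qed

lemma abs_convex_comb_le:
  fixes s :: real
  assumes "0 \<le> s" "s \<le> 1" "\<bar>u\<bar> \<le> c" "\<bar>v\<bar> \<le> c"
  shows "\<bar>(1 - s) * u + s * v\<bar> \<le> c"
proof -
  have "\<bar>(1 - s) * u + s * v\<bar> \<le> (1 - s) * \<bar>u\<bar> + s * \<bar>v\<bar>"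
    using assms by (intro order_trans[OF abs_triangle_ineq]) (simp add: abs_mult)
  also have "\<dots> \<le> (1 - s) * c + s * c"
    using assms by (intro add_mono mult_left_mono) auto
  finally show ?thesis by (simp add: algebra_simps)
qed

lemma interp_lipschitz:
  assumes a: "\<And>n. \<bar>a (Suc n) - a n\<bar> \<le> 1" and "0 \<le> x" "0 \<le> y"
  shows "\<bar>interp a y - interp a x\<bar> \<le> \<bar>y - x\<bar>"
proof -
  have cell: "\<bar>interp a z - interp a y\<bar> \<le> z - y"
    if "real n \<le> y" "y \<le> z" "z \<le> real n + 1" for n y z
  proof -
    have "interp a z - interp a y = (z - y) * (a (Suc n) - a n)"
      using that by (simp add: interp_affine[of n] algebra_simps)
    then show ?thesis
      using a[of n] that by (simp add: abs_mult mult_le_cancel_left1 mult_left_le)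
  qed
  have seq: "\<bar>a (n + k) - a n\<bar> \<le> real k" for n k
  proof (induction k)
    case (Suc k)
    then show ?case using a[of "n + k"] by simp
  qed simp
  have "\<bar>interp a z - interp a w\<bar> \<le> z - w" if w: "0 \<le> w" and wz: "w \<le> z" for w z
  proof -
    define m where "m = nat \<lfloor>w\<rfloor>"
    define n where "n = nat \<lfloor>z\<rfloor>"
    have m: "real m \<le> w" "w \<le> real m + 1" using w by (auto simp: m_def)
    have n: "real n \<le> z" "z \<le> real n + 1" using w wz by (auto simp: n_def)
    show ?thesis
    proof (cases "m = n")
      case True
      then show ?thesis using cell[of m w z] m n wz by auto
    next
      case False
      have "m \<le> n" using wz unfolding m_def n_def by (intro nat_mono floor_mono)
      with False obtain k where k: "n = Suc m + k" by (metis add_Suc le_neq_implies_less less_iff_Suc_add)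
      have "\<bar>interp a (real (Suc m)) - interp a w\<bar> \<le> real (Suc m) - w"
        using cell[of m w "real (Suc m)"] m by auto
      moreover have "\<bar>interp a z - interp a (real n)\<bar> \<le> z - real n"
        using cell[of n "real n" z] n by auto
      moreover have "\<bar>a n - a (Suc m)\<bar> \<le> real n - real (Suc m)"
        using seq[of "Suc m" k] k by simp
      ultimately show ?thesis unfolding interp_of_nat by linarith
    qed
  qed
  from this[of x y] this[of y x] assms(2,3) show ?thesis by (cases "x \<le> y") auto
qed

lemma abs_height_increments_le_1:
  "\<bar>of_int (height lft btm \<omega> (Suc x) y) - of_int (height lft btm \<omega> x y)\<bar> \<le> (1 :: real)"
  "\<bar>of_int (height lft btm \<omega> x (Suc y)) - of_int (height lft btm \<omega> x y)\<bar> \<le> (1 :: real)"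
proof -
  have "\<bar>height lft btm \<omega> (Suc x) y - height lft btm \<omega> x y\<bar> \<le> 1"
    "\<bar>height lft btm \<omega> x (Suc y) - height lft btm \<omega> x y\<bar> \<le> 1"
    unfolding height_increments by auto
  then show "\<bar>of_int (height lft btm \<omega> (Suc x) y) - of_int (height lft btm \<omega> x y)\<bar> \<le> (1 :: real)"
    "\<bar>of_int (height lft btm \<omega> x (Suc y)) - of_int (height lft btm \<omega> x y)\<bar> \<le> (1 :: real)"
    by linarith+
qed

lemma height_xy_lipschitz:
  assumes "0 \<le> x" "0 \<le> x'" "0 \<le> y" "0 \<le> y'"
  shows "\<bar>height_xy lft btm \<omega> x' y' - height_xy lft btm \<omega> x y\<bar> \<le> \<bar>x' - x\<bar> + \<bar>y' - y\<bar>"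
proof -
  \<comment> \<open>The interpolation in \<open>y\<close> is a convex combination, hence keeps the Lipschitz bound in \<open>x\<close>.\<close>
  have hx: "\<bar>height_x lft btm \<omega> x' n - height_x lft btm \<omega> x n\<bar> \<le> \<bar>x' - x\<bar>" for n
    unfolding height_x_eq using assms
    by (intro interp_lipschitz abs_height_increments_le_1)
  have "height_xy lft btm \<omega> x' y' - height_xy lft btm \<omega> x y' =
      (1 - frac y') * (height_x lft btm \<omega> x' (nat \<lfloor>y'\<rfloor>) - height_x lft btm \<omega> x (nat \<lfloor>y'\<rfloor>))
      + frac y' * (height_x lft btm \<omega> x' (nat \<lfloor>y'\<rfloor> + 1) - height_x lft btm \<omega> x (nat \<lfloor>y'\<rfloor> + 1))"
    by (simp add: height_xy_def algebra_simps)
  also have "\<bar>\<dots>\<bar> \<le> \<bar>x' - x\<bar>"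
    using frac_lt_1[of y'] by (intro abs_convex_comb_le hx) auto
  finally have 1: "\<bar>height_xy lft btm \<omega> x' y' - height_xy lft btm \<omega> x y'\<bar> \<le> \<bar>x' - x\<bar>" .
  have "\<bar>height_x lft btm \<omega> x (Suc n) - height_x lft btm \<omega> x n\<bar> \<le> 1" for n
  proof -
    let ?h = "\<lambda>i n. of_int (height lft btm \<omega> i n) :: real" and ?i = "nat \<lfloor>x\<rfloor>"
    have "height_x lft btm \<omega> x (Suc n) - height_x lft btm \<omega> x n =
        (1 - frac x) * (?h ?i (Suc n) - ?h ?i n) + frac x * (?h (?i + 1) (Suc n) - ?h (?i + 1) n)"
      unfolding height_x_def by (simp add: algebra_simps del: height.simps)
    also have "\<bar>\<dots>\<bar> \<le> 1"
      using frac_lt_1[of x] by (intro abs_convex_comb_le abs_height_increments_le_1) auto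
    finally show ?thesis .
  qed
  then have "\<bar>height_xy lft btm \<omega> x y' - height_xy lft btm \<omega> x y\<bar> \<le> \<bar>y' - y\<bar>"
    unfolding height_xy_eq using assms by (intro interp_lipschitz)
  with 1 show ?thesis by linarith
qed

lemma height_xy_of_nat:
  "height_xy lft btm \<omega> (real i) (real j) = of_int (height lft btm \<omega> i j)"
  by (simp add: height_xy_eq height_x_eq)

lemma height_xy_determined:
  assumes "0 \<le> x" "0 \<le> y" "x < real N" "y < real N"
    and "\<And>i j. i \<le> N \<Longrightarrow> j \<le> N \<Longrightarrow> \<omega> (i, j) = \<omega>' (i, j)"
  shows "height_xy lft btm \<omega> x y = height_xy lft btm \<omega>' x y"
proof -
  have floor: "nat \<lfloor>z\<rfloor> + 1 \<le> N" if "0 \<le> z" "z < real N" for z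
    using that by linarith
  have "height lft btm \<omega> i j = height lft btm \<omega>' i j" if "i \<le> N" "j \<le> N" for i j
    using that assms(5) by (intro height_determined) auto
  then show ?thesis
    using floor[OF assms(1,3)] floor[OF assms(2,4)]
    unfolding height_xy_def height_x_def by (simp del: height.simps)
qed

section \<open>The noise of the four-point relation\<close>

text \<open>
  The defect in the linear four-point relation for \<open>q\<close> to the power of the height around the vertex
  \<open>(x + 1, y + 1)\<close>; the index refers to the lower left of the four faces.
\<close>

definition noise ::
  "real \<Rightarrow> real \<Rightarrow> (nat \<Rightarrow> bool) \<Rightarrow> (nat \<Rightarrow> bool) \<Rightarrow> (nat \<times> nat \<Rightarrow> bool \<times> bool) \<Rightarrow> nat \<Rightarrow> nat \<Rightarrow> real"
  where
  "noise b q lft btm \<omega> x y =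
     q powi height lft btm \<omega> (Suc x) (Suc y)
     - b * q powi height lft btm \<omega> x (Suc y)
     - b * q * q powi height lft btm \<omega> (Suc x) y
     + (b + b * q - 1) * q powi height lft btm \<omega> x y"

text \<open>
  The noise in units of the value on the lower left face, as a function of the coins \<open>c\<close> of the vertex and
  of the presence of a path from the left (\<open>l\<close>) and from below (\<open>d\<close>).
\<close>

definition vertex_noise :: "real \<Rightarrow> real \<Rightarrow> bool \<times> bool \<Rightarrow> bool \<Rightarrow> bool \<Rightarrow> real" where
  "vertex_noise b q c l d =
     (if l = d then 0
      else if l then (of_bool (fst c) - b) * (q - 1)
      else (of_bool (snd c) - b * q) * (inverse q - 1))"

text \<open>
  An upper bound for the variance of \<open>vertex_noise\<close> in all four cases.
\<close>

definition noise_variance :: "real \<Rightarrow> real \<Rightarrow> real" where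
  "noise_variance b q = (1 - b) * (q - 1)\<^sup>2 + (1 - b * q) * (inverse q - 1)\<^sup>2"

text \<open>
  The coefficients of the four-point relation are chosen to make this work: without a path or with
  two paths they cancel, and with one path the relation centers the coin that decides whether the
  path goes straight.
\<close>

lemma noise_eq:
  assumes "q > 0"
  shows "noise b q lft btm \<omega> x y =
    q powi height lft btm \<omega> x y *
    vertex_noise b q (\<omega> (Suc x, Suc y))
      (fst (outgoing lft btm \<omega> x (Suc y))) (snd (outgoing lft btm \<omega> (Suc x) y))"
proof -
  define h where "h = height lft btm \<omega> x y"
  define l where "l = fst (outgoing lft btm \<omega> x (Suc y))"
  define d where "d = snd (outgoing lft btm \<omega> (Suc x) y)"
  obtain s t where st: "\<omega> (Suc x, Suc y) = (s, t)" by fastforce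
  have h1: "height lft btm \<omega> x (Suc y) = h + of_bool l"
    using height_increments(2)[of lft btm \<omega> x y] by (simp add: h_def l_def)
  have h2: "height lft btm \<omega> (Suc x) y = h - of_bool d"
    using height_increments(3)[of lft btm \<omega> x y] by (simp add: h_def d_def)
  have h3: "height lft btm \<omega> (Suc x) (Suc y) = h - of_bool d + of_bool (fst (vertex_out (s, t) l d))"
    using height_increments(2)[of lft btm \<omega> "Suc x" y] h2 st by (simp add: l_def d_def)
  show ?thesis
    unfolding noise_def h1 h2 h3 h_def[symmetric] l_def[symmetric] d_def[symmetric] st
    using assms
    by (cases l; cases d; cases s; cases t)
       (simp_all add: vertex_noise_def power_int_add power_int_diff field_simps)
qed

lemma vertex_noise_mean:
  assumes "0 \<le> b" "b \<le> 1" "0 \<le> b * q" "b * q \<le> 1"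
  shows "(\<integral>c. vertex_noise b q c l d \<partial>vertex_coins b q) = 0"
proof -
  have "(\<integral>c. (of_bool (fst c) - b) * (q - 1) \<partial>vertex_coins b q) =
      (\<integral>s. (of_bool s - b) * (q - 1) \<partial>bernoulli_pmf b)"
    unfolding vertex_coins_def by (rule expectation_pair_pmf_fst)
  moreover have "(\<integral>c. (of_bool (snd c) - b * q) * (inverse q - 1) \<partial>vertex_coins b q) =
      (\<integral>t. (of_bool t - b * q) * (inverse q - 1) \<partial>bernoulli_pmf (b * q))"
    unfolding vertex_coins_def by (rule expectation_pair_pmf_snd)
  moreover have "(\<integral>s. (of_bool s - p) * r \<partial>bernoulli_pmf p) = 0" if "0 \<le> p" "p \<le> 1" for p r :: real
    using that by (simp add: algebra_simps)
  ultimately show ?thesis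
    using assms by (cases l; cases d) (simp_all add: vertex_noise_def)
qed

lemma vertex_noise_variance:
  assumes "0 \<le> b" "b \<le> 1" "0 \<le> b * q" "b * q \<le> 1"
  shows "(\<integral>c. (vertex_noise b q c l d)\<^sup>2 \<partial>vertex_coins b q) \<le> noise_variance b q"
proof -
  have bern: "(\<integral>s. ((of_bool s - p) * r)\<^sup>2 \<partial>bernoulli_pmf p) \<le> (1 - p) * r\<^sup>2"
    if "0 \<le> p" "p \<le> 1" for p r :: real
  proof -
    have "(\<integral>s. ((of_bool s - p) * r)\<^sup>2 \<partial>bernoulli_pmf p) = p * ((1 - p) * r\<^sup>2)"
      using that by (simp add: power2_eq_square algebra_simps)
    also have "\<dots> \<le> (1 - p) * r\<^sup>2"
      using that by (intro mult_left_le_one_le) auto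
    finally show ?thesis .
  qed
  have "(\<integral>c. ((of_bool (fst c) - b) * (q - 1))\<^sup>2 \<partial>vertex_coins b q) \<le> (1 - b) * (q - 1)\<^sup>2"
    using bern[OF assms(1,2)] unfolding vertex_coins_def by (subst expectation_pair_pmf_fst)
  moreover have "(\<integral>c. ((of_bool (snd c) - b * q) * (inverse q - 1))\<^sup>2 \<partial>vertex_coins b q)
      \<le> (1 - b * q) * (inverse q - 1)\<^sup>2"
    using bern[OF assms(3,4)] unfolding vertex_coins_def by (subst expectation_pair_pmf_snd)
  moreover have "0 \<le> (1 - b) * (q - 1)\<^sup>2" "0 \<le> (1 - b * q) * (inverse q - 1)\<^sup>2"
    using assms by simp_all
  ultimately show ?thesis
    by (cases l; cases d) (simp_all add: vertex_noise_def noise_variance_def)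
qed

lemma noise_determined:
  assumes "\<And>i j. i \<le> Suc x \<Longrightarrow> j \<le> Suc y \<Longrightarrow> \<omega> (i, j) = \<omega>' (i, j)"
  shows "noise b q lft btm \<omega> x y = noise b q lft btm \<omega>' x y"
  unfolding noise_def
  using assms
    height_determined[of "Suc x" "Suc y" \<omega> \<omega>' lft btm] height_determined[of x "Suc y" \<omega> \<omega>' lft btm]
    height_determined[of "Suc x" y \<omega> \<omega>' lft btm] height_determined[of x y \<omega> \<omega>' lft btm]
  by (simp del: height.simps)

lemma determined_by_noise:
  "determined_by ({..Suc x} \<times> {..Suc y}) (\<lambda>\<omega>. noise b q lft btm \<omega> x y)"
  unfolding determined_by_def by (auto intro: noise_determined)

lemma determined_by_noise_product:
  "determined_by ({..Suc x} \<times> {..Suc y} \<union> {..Suc x'} \<times> {..Suc y'})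
    (\<lambda>\<omega>. noise b q lft btm \<omega> x y * noise b q lft btm \<omega> x' y')"
  unfolding determined_by_def by (auto intro!: arg_cong2[where f = "(*)"] noise_determined)

lemma determined_by_resample:
  assumes "determined_by S f"
  shows "determined_by S (\<lambda>\<omega>. \<integral>c. f (fun_upd \<omega> v c) \<partial>vertex_coins b q)"
  unfolding determined_by_def
proof (intro allI impI Bochner_Integration.integral_cong refl)
  fix \<omega> \<omega>' :: "'a \<Rightarrow> bool \<times> bool" and c assume "\<forall>s\<in>S. \<omega> s = \<omega>' s"
  then have "\<forall>s\<in>S. (fun_upd \<omega> v c) s = (fun_upd \<omega>' v c) s" by simp
  then show "f (fun_upd \<omega> v c) = f (fun_upd \<omega>' v c)"
    using assms unfolding determined_by_def by blast
qed

text \<open>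
  The coins of a vertex influence neither the paths that enter it nor the height to its lower left.
\<close>

lemma noise_resample_own_coin:
  assumes "q > 0"
  shows "noise b q lft btm (fun_upd \<omega> (Suc x, Suc y) c) x y =
    q powi height lft btm \<omega> x y *
    vertex_noise b q c
      (fst (outgoing lft btm \<omega> x (Suc y))) (snd (outgoing lft btm \<omega> (Suc x) y))"
proof -
  let ?\<omega> = "fun_upd \<omega> (Suc x, Suc y) c"
  have "height lft btm ?\<omega> x y = height lft btm \<omega> x y"
    by (rule height_determined) auto
  moreover have "outgoing lft btm ?\<omega> x (Suc y) = outgoing lft btm \<omega> x (Suc y)"
    by (rule outgoing_determined) auto
  moreover have "outgoing lft btm ?\<omega> (Suc x) y = outgoing lft btm \<omega> (Suc x) y"
    by (rule outgoing_determined) auto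
  ultimately show ?thesis
    using noise_eq[OF assms, of b lft btm ?\<omega> x y] by (simp only: fun_upd_same)
qed

lemma noise_resample_other_coin:
  assumes "\<not> (x \<le> x' \<and> y \<le> y')"
  shows "noise b q lft btm (fun_upd \<omega> (Suc x, Suc y) c) x' y' = noise b q lft btm \<omega> x' y'"
proof (rule noise_determined)
  fix i j assume "i \<le> Suc x'" "j \<le> Suc y'"
  then have "(i, j) \<noteq> (Suc x, Suc y)" using assms by auto
  then show "(fun_upd \<omega> (Suc x, Suc y) c) (i, j) = \<omega> (i, j)" by (rule fun_upd_other)
qed

text \<open>
  Of two different vertices, at least one is not to the lower left of the other. Its coins do not
  enter the other noise, and averaging over them annihilates the product.
\<close>

lemma noise_orthogonal:
  assumes "0 \<le> b" "b \<le> 1" "0 < q" "b * q \<le> 1" and "(x, y) \<noteq> (x', y')"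
  shows "(\<integral>\<omega>. noise b q lft btm \<omega> x y * noise b q lft btm \<omega> x' y' \<partial>six_vertex_space b q) = 0"
proof -
  have *: "(\<integral>\<omega>. noise b q lft btm \<omega> x y * noise b q lft btm \<omega> x' y' \<partial>six_vertex_space b q) = 0"
    if "\<not> (x \<le> x' \<and> y \<le> y')" for x y x' y'
  proof -
    have "(\<integral>\<omega>. noise b q lft btm \<omega> x y * noise b q lft btm \<omega> x' y' \<partial>six_vertex_space b q) =
      (\<integral>\<omega>. (\<integral>c. noise b q lft btm (fun_upd \<omega> (Suc x, Suc y) c) x y *
                noise b q lft btm (fun_upd \<omega> (Suc x, Suc y) c) x' y' \<partial>vertex_coins b q)
         \<partial>six_vertex_space b q)"
      by (rule integral_resample_coin[OF _ determined_by_noise_product]) auto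
    also have "\<dots> = 0"
      using vertex_noise_mean[of b q] assms
      by (simp add: noise_resample_own_coin noise_resample_other_coin[OF that] del: height.simps outgoing.simps)
    finally show ?thesis .
  qed
  show ?thesis
  proof (cases "x \<le> x' \<and> y \<le> y'")
    case True
    then have "\<not> (x' \<le> x \<and> y' \<le> y)" using assms by auto
    from *[OF this] show ?thesis by (simp add: mult.commute)
  qed (rule *)
qed

lemma noise_second_moment:
  assumes b: "0 \<le> b" "b \<le> 1" "0 < q" "b * q \<le> 1"
    and \<Gamma>: "\<And>\<omega>. q powi height lft btm \<omega> x y \<le> \<Gamma>"
  shows "(\<integral>\<omega>. (noise b q lft btm \<omega> x y)\<^sup>2 \<partial>six_vertex_space b q) \<le> \<Gamma>\<^sup>2 * noise_variance b q"
proof -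
  interpret prob_space "six_vertex_space b q" by (rule prob_space_six_vertex_space)
  let ?S = "{..Suc x} \<times> {..Suc y}"
  have det: "determined_by ?S (\<lambda>\<omega>. (noise b q lft btm \<omega> x y)\<^sup>2)"
    using determined_by_noise[of x y b q lft btm] unfolding determined_by_def by metis
  have v0: "0 \<le> noise_variance b q" using b by (simp add: noise_variance_def)
  have "(\<integral>\<omega>. (noise b q lft btm \<omega> x y)\<^sup>2 \<partial>six_vertex_space b q) =
    (\<integral>\<omega>. (\<integral>c. (noise b q lft btm (fun_upd \<omega> (Suc x, Suc y) c) x y)\<^sup>2 \<partial>vertex_coins b q)
       \<partial>six_vertex_space b q)"
    by (rule integral_resample_coin[OF _ det]) auto
  also have "\<dots> \<le> \<Gamma>\<^sup>2 * noise_variance b q"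
  proof (rule integral_le_const)
    show "integrable (six_vertex_space b q)
      (\<lambda>\<omega>. \<integral>c. (noise b q lft btm (fun_upd \<omega> (Suc x, Suc y) c) x y)\<^sup>2 \<partial>vertex_coins b q)"
      by (rule integrable_determined_by[OF _ determined_by_resample[OF det]]) auto
    show "AE \<omega> in six_vertex_space b q.
      (\<integral>c. (noise b q lft btm (fun_upd \<omega> (Suc x, Suc y) c) x y)\<^sup>2 \<partial>vertex_coins b q)
        \<le> \<Gamma>\<^sup>2 * noise_variance b q"
    proof (rule AE_I2)
      fix \<omega>
      let ?l = "fst (outgoing lft btm \<omega> x (Suc y))" and ?d = "snd (outgoing lft btm \<omega> (Suc x) y)"
      have "(\<integral>c. (noise b q lft btm (fun_upd \<omega> (Suc x, Suc y) c) x y)\<^sup>2 \<partial>vertex_coins b q) =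
        (q powi height lft btm \<omega> x y)\<^sup>2 * (\<integral>c. (vertex_noise b q c ?l ?d)\<^sup>2 \<partial>vertex_coins b q)"
        by (simp add: noise_resample_own_coin[OF b(3)] power_mult_distrib del: height.simps outgoing.simps)
      also have "\<dots> \<le> \<Gamma>\<^sup>2 * noise_variance b q"
        using b \<Gamma>[of \<omega>] by (intro mult_mono power_mono vertex_noise_variance) (auto simp: v0)
      finally show "(\<integral>c. (noise b q lft btm (fun_upd \<omega> (Suc x, Suc y) c) x y)\<^sup>2 \<partial>vertex_coins b q)
        \<le> \<Gamma>\<^sup>2 * noise_variance b q" .
    qed
  qed
  finally show ?thesis .
qed

definition noise_sum ::
  "real \<Rightarrow> real \<Rightarrow> (nat \<Rightarrow> bool) \<Rightarrow> (nat \<Rightarrow> bool) \<Rightarrow> nat \<Rightarrow> nat \<Rightarrow> (nat \<times> nat \<Rightarrow> bool \<times> bool) \<Rightarrow> real"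
  where
  "noise_sum b q lft btm X Y \<omega> = (\<Sum>x<X. \<Sum>y<Y. noise b q lft btm \<omega> x y)"

lemma determined_by_noise_sum:
  "determined_by ({..X} \<times> {..Y}) (noise_sum b q lft btm X Y)"
  unfolding determined_by_def noise_sum_def
  by (auto intro!: sum.cong noise_determined)

text \<open>
  Orthogonality leaves only the diagonal terms, so the second moment grows with the number of
  vertices and not with its square.
\<close>

lemma noise_sum_second_moment:
  assumes b: "0 \<le> b" "b \<le> 1" "0 < q" "b * q \<le> 1"
    and \<Gamma>: "\<And>x y \<omega>. x < X \<Longrightarrow> y < Y \<Longrightarrow> q powi height lft btm \<omega> x y \<le> \<Gamma>"
  shows "(\<integral>\<omega>. (noise_sum b q lft btm X Y \<omega>)\<^sup>2 \<partial>six_vertex_space b q)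
    \<le> real X * real Y * (\<Gamma>\<^sup>2 * noise_variance b q)"
proof -
  let ?V = "{..<X} \<times> {..<Y}" and ?P = "six_vertex_space b q"
  let ?\<nu> = "\<lambda>v \<omega>. noise b q lft btm \<omega> (fst v) (snd v)"
  have int: "integrable ?P (\<lambda>\<omega>. ?\<nu> v \<omega> * ?\<nu> w \<omega>)" for v w
    by (rule integrable_determined_by[OF _ determined_by_noise_product]) auto
  have "(\<integral>\<omega>. (noise_sum b q lft btm X Y \<omega>)\<^sup>2 \<partial>?P) = (\<integral>\<omega>. (\<Sum>v\<in>?V. \<Sum>w\<in>?V. ?\<nu> v \<omega> * ?\<nu> w \<omega>) \<partial>?P)"
    by (simp add: noise_sum_def sum.cartesian_product case_prod_unfold power2_eq_square sum_product)
  also have "\<dots> = (\<Sum>v\<in>?V. \<Sum>w\<in>?V. (\<integral>\<omega>. ?\<nu> v \<omega> * ?\<nu> w \<omega> \<partial>?P))"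
    by (simp add: int integrable_sum)
  also have "\<dots> = (\<Sum>v\<in>?V. \<Sum>w\<in>?V. if w = v then (\<integral>\<omega>. (?\<nu> v \<omega>)\<^sup>2 \<partial>?P) else 0)"
  proof (intro sum.cong refl)
    fix v w
    show "(\<integral>\<omega>. ?\<nu> v \<omega> * ?\<nu> w \<omega> \<partial>?P) = (if w = v then (\<integral>\<omega>. (?\<nu> v \<omega>)\<^sup>2 \<partial>?P) else 0)"
      using noise_orthogonal[OF b, of "fst v" "snd v" "fst w" "snd w"]
      by (auto simp: power2_eq_square prod_eq_iff)
  qed
  also have "\<dots> = (\<Sum>v\<in>?V. (\<integral>\<omega>. (?\<nu> v \<omega>)\<^sup>2 \<partial>?P))"
    by (intro sum.cong refl) (simp add: sum.delta)
  also have "\<dots> \<le> (\<Sum>v\<in>?V. \<Gamma>\<^sup>2 * noise_variance b q)"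
    by (intro sum_mono noise_second_moment[OF b] \<Gamma>) auto
  also have "\<dots> = real X * real Y * (\<Gamma>\<^sup>2 * noise_variance b q)"
    by (simp add: card_cartesian_product)
  finally show ?thesis .
qed

text \<open>
  The mixed difference telescopes in both directions and each first-order term in one direction,
  which leaves a discrete form of the integrated equation.
\<close>

lemma four_point_summation:
  fixes F :: "nat \<Rightarrow> nat \<Rightarrow> real"
  shows "(\<Sum>x<X. \<Sum>y<Y. F (Suc x) (Suc y) - b * F x (Suc y) - c * F (Suc x) y + (b + c - 1) * F x y) =
    F X Y - F X 0 - F 0 Y + F 0 0
    + (1 - c) * (\<Sum>y<Y. F X y - F 0 y) + (1 - b) * (\<Sum>x<X. F x Y - F x 0)"
proof -
  have row: "(\<Sum>y<Y. F (Suc x) (Suc y) - b * F x (Suc y) - c * F (Suc x) y + (b + c - 1) * F x y) =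
      F (Suc x) Y - F (Suc x) 0 - F x Y + F x 0
      + (1 - c) * (\<Sum>y<Y. F (Suc x) y - F x y) + (1 - b) * (F x Y - F x 0)" for x
    by (induction Y) (simp_all add: algebra_simps)
  show ?thesis
    unfolding row by (induction X) (simp_all add: algebra_simps sum_subtractf)
qed

lemma noise_sum_eq:
  "noise_sum b q lft btm X Y \<omega> =
    q powi height lft btm \<omega> X Y - q powi height lft btm \<omega> X 0
    - q powi height lft btm \<omega> 0 Y + q powi height lft btm \<omega> 0 0
    + (1 - b * q) * (\<Sum>y<Y. q powi height lft btm \<omega> X y - q powi height lft btm \<omega> 0 y)
    + (1 - b) * (\<Sum>x<X. q powi height lft btm \<omega> x Y - q powi height lft btm \<omega> x 0)"
  unfolding noise_sum_def noise_def by (rule four_point_summation[where c = "b * q" and F = "\<lambda>x y. q powi height lft btm \<omega> x y"])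

section \<open>From the lattice to the continuum\<close>

lemma one_minus_exp_minus_approx:
  fixes t :: real
  assumes "0 \<le> t"
  shows "\<bar>t - (1 - exp (- t))\<bar> \<le> t\<^sup>2"
proof -
  have 1: "1 - t \<le> exp (- t)" using exp_ge_add_one_self[of "- t"] by simp
  have "exp (- t) \<le> 1 / (1 + t)"
    using exp_ge_add_one_self[of t] assms by (simp add: exp_minus field_simps)
  also have "\<dots> \<le> 1 - t + t\<^sup>2"
  proof -
    have "(1 - t + t\<^sup>2) * (1 + t) = 1 + t * t\<^sup>2" by (simp add: algebra_simps power2_eq_square)
    moreover have "0 \<le> t * t\<^sup>2" using assms by simp
    ultimately show ?thesis using assms by (simp add: divide_le_eq)
  qed
  finally show ?thesis using 1 by simp
qed

lemma riemann_sum_error: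
  fixes \<phi> :: "real \<Rightarrow> real"
  assumes L: "L > 0"
    and lip: "\<And>s t. 0 \<le> s \<Longrightarrow> s \<le> t \<Longrightarrow> t \<le> real n / L \<Longrightarrow> \<bar>\<phi> t - \<phi> s\<bar> \<le> K * (t - s)"
    and cont: "continuous_on {0..real n / L} \<phi>"
  shows "\<bar>integral {0..real n / L} \<phi> - (\<Sum>k<n. \<phi> (real k / L)) / L\<bar> \<le> real n * (K / L\<^sup>2)"
  using lip cont
proof (induction n)
  case 0
  then show ?case by simp
next
  case (Suc n)
  let ?a = "real n / L" and ?b = "real (Suc n) / L"
  have ab: "0 \<le> ?a" "?a \<le> ?b" "?b - ?a = 1 / L" using L by (auto simp: field_simps)
  have IH: "\<bar>integral {0..?a} \<phi> - (\<Sum>k<n. \<phi> (real k / L)) / L\<bar> \<le> real n * (K / L\<^sup>2)"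
  proof (rule Suc.IH)
    show "\<bar>\<phi> t - \<phi> s\<bar> \<le> K * (t - s)" if "0 \<le> s" "s \<le> t" "t \<le> ?a" for s t
      using that ab by (intro Suc.prems) auto
    show "continuous_on {0..?a} \<phi>"
      using ab by (intro continuous_on_subset[OF Suc.prems(2)]) auto
  qed
  have int: "\<phi> integrable_on {0..?b}"
    using Suc.prems(2) by (rule integrable_continuous_interval)
  have int': "\<phi> integrable_on {?a..?b}"
    using ab by (intro integrable_continuous_interval continuous_on_subset[OF Suc.prems(2)]) auto
  have K: "0 \<le> K"
  proof -
    have "0 \<le> K * (?b - ?a)" using Suc.prems(1)[of ?a ?b] ab by linarith
    then show ?thesis using L unfolding ab(3) by (simp add: zero_le_divide_iff)
  qed
  have "norm (integral (cbox ?a ?b) (\<lambda>t. \<phi> t - \<phi> ?a)) \<le> (K * (1 / L)) * measure lborel (cbox ?a ?b)"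
  proof (rule integrable_bound)
    show "norm (\<phi> t - \<phi> ?a) \<le> K * (1 / L)" if "t \<in> cbox ?a ?b" for t
    proof -
      have "\<bar>\<phi> t - \<phi> ?a\<bar> \<le> K * (t - ?a)" using that ab by (intro Suc.prems) auto
      also have "\<dots> \<le> K * (1 / L)" using that K ab(3) by (intro mult_left_mono) auto
      finally show ?thesis by simp
    qed
  qed (use K L int' in \<open>auto intro!: integrable_diff\<close>)
  moreover have "integral {?a..?b} (\<lambda>t. \<phi> t - \<phi> ?a) = integral {?a..?b} \<phi> - \<phi> ?a / L"
    using int' ab by (subst integral_diff) (auto simp: mult.commute divide_inverse)
  ultimately have cell: "\<bar>integral {?a..?b} \<phi> - \<phi> ?a / L\<bar> \<le> K / L\<^sup>2"
    using ab by (simp add: power2_eq_square)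
  have "integral {0..?b} \<phi> = integral {0..?a} \<phi> + integral {?a..?b} \<phi>"
    using Henstock_Kurzweil_Integration.integral_combine[OF ab(1,2) int] by simp
  then have "integral {0..?b} \<phi> - (\<Sum>k<Suc n. \<phi> (real k / L)) / L =
      (integral {0..?a} \<phi> - (\<Sum>k<n. \<phi> (real k / L)) / L) + (integral {?a..?b} \<phi> - \<phi> ?a / L)"
    by (simp add: add_divide_distrib)
  also have "\<bar>\<dots>\<bar> \<le> real (Suc n) * (K / L\<^sup>2)"
    using IH cell unfolding of_nat_Suc distrib_right mult_1 by linarith
  finally show ?case .
qed

text \<open>
  Compares an integral term of the limiting equation with its discrete counterpart. Two errors of
  order \<open>1 / L\<close> occur: that of the Riemann sum, and that of replacing \<open>\<beta> / L\<close> by \<open>1 - exp (- \<beta> / L)\<close>.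
\<close>

lemma damped_sum_error:
  fixes \<phi> :: "real \<Rightarrow> real"
  assumes L: "L > 0" and \<beta>: "0 \<le> \<beta>" and n: "real n / L \<le> a"
    and lip: "\<And>s t. 0 \<le> s \<Longrightarrow> s \<le> t \<Longrightarrow> t \<le> a \<Longrightarrow> \<bar>\<phi> t - \<phi> s\<bar> \<le> K * (t - s)"
    and bound: "\<And>t. 0 \<le> t \<Longrightarrow> t \<le> a \<Longrightarrow> \<bar>\<phi> t\<bar> \<le> M"
    and cont: "continuous_on {0..a} \<phi>" and K: "0 \<le> K"
  shows "\<bar>\<beta> * integral {0..real n / L} \<phi> - (1 - exp (- \<beta> / L)) * (\<Sum>k<n. \<phi> (real k / L))\<bar>
    \<le> (\<beta> * a * K + \<beta>\<^sup>2 * a * M) / L"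
proof -
  let ?I = "integral {0..real n / L} \<phi>" and ?S = "\<Sum>k<n. \<phi> (real k / L)"
  have a: "0 \<le> a" using n L by (meson divide_nonneg_pos of_nat_0_le_iff order_trans)
  have "\<bar>?I - ?S / L\<bar> \<le> real n * (K / L\<^sup>2)"
    using n by (intro riemann_sum_error[OF L] lip continuous_on_subset[OF cont]) auto
  also have "\<dots> = (real n / L) * K / L" by (simp add: power2_eq_square)
  also have "\<dots> \<le> a * K / L" using n K L by (intro divide_right_mono mult_right_mono) auto
  finally have 1: "\<bar>\<beta> * (?I - ?S / L)\<bar> \<le> \<beta> * (a * K / L)"
    using mult_left_mono[OF _ \<beta>] \<beta> by (simp only: abs_mult abs_of_nonneg)
  have M: "0 \<le> M" using bound[of 0] a by auto
  have "\<bar>?S\<bar> \<le> (\<Sum>k<n. M)"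
  proof (rule order_trans[OF sum_abs sum_mono])
    fix k assume "k \<in> {..<n}"
    then have "real k / L \<le> real n / L" using L by (intro divide_right_mono) auto
    then show "\<bar>\<phi> (real k / L)\<bar> \<le> M" using n L by (intro bound) auto
  qed
  then have S: "\<bar>?S\<bar> \<le> real n * M" by simp
  have "\<bar>(\<beta> / L - (1 - exp (- (\<beta> / L)))) * ?S\<bar> \<le> (\<beta> / L)\<^sup>2 * (real n * M)"
    unfolding abs_mult using S \<beta> L
    by (intro mult_mono one_minus_exp_minus_approx) auto
  also have "\<dots> = \<beta>\<^sup>2 * (real n / L) * M / L" by (simp add: power2_eq_square)
  also have "\<dots> \<le> \<beta>\<^sup>2 * a * M / L"
    using n M L by (intro divide_right_mono mult_right_mono mult_left_mono) auto
  finally have 2: "\<bar>(\<beta> / L - (1 - exp (- (\<beta> / L)))) * ?S\<bar> \<le> \<beta>\<^sup>2 * a * M / L" .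
  have "\<beta> * ?I - (1 - exp (- \<beta> / L)) * ?S =
      \<beta> * (?I - ?S / L) + (\<beta> / L - (1 - exp (- (\<beta> / L)))) * ?S"
    by (simp add: algebra_simps)
  also have "\<bar>\<dots>\<bar> \<le> \<beta> * (a * K / L) + \<beta>\<^sup>2 * a * M / L"
    using 1 2 by linarith
  finally show ?thesis by (simp add: add_divide_distrib)
qed

text \<open>
  The regularity of the rescaled exponential height. It holds for every realization, with
  constants independent of \<open>L\<close>, so that all discretization errors below are deterministic.
\<close>

locale lipschitz_on_rectangle =
  fixes A B \<Lambda> \<Gamma> :: real and g :: "real \<Rightarrow> real \<Rightarrow> real"
  assumes \<Lambda>_nonneg: "0 \<le> \<Lambda>"
    and lip: "\<And>x x' y y'. \<lbrakk>x \<in> {0..A}; x' \<in> {0..A}; y \<in> {0..B}; y' \<in> {0..B}\<rbrakk> \<Longrightarrow>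
      \<bar>g x' y' - g x y\<bar> \<le> \<Lambda> * (\<bar>x' - x\<bar> + \<bar>y' - y\<bar>)"
    and bound: "\<And>x y. \<lbrakk>x \<in> {0..A}; y \<in> {0..B}\<rbrakk> \<Longrightarrow> \<bar>g x y\<bar> \<le> \<Gamma>"
begin

lemma continuous: "continuous_on ({0..A} \<times> {0..B}) (\<lambda>(x, y). g x y)"
proof (rule lipschitz_on_continuous_on[of "2 * \<Lambda>"], rule lipschitz_onI)
  fix p p' :: "real \<times> real" assume p: "p \<in> {0..A} \<times> {0..B}" "p' \<in> {0..A} \<times> {0..B}"
  have "\<bar>g (fst p) (snd p) - g (fst p') (snd p')\<bar> \<le> \<Lambda> * (\<bar>fst p - fst p'\<bar> + \<bar>snd p - snd p'\<bar>)"
    using p by (intro lip) auto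
  also have "\<dots> \<le> \<Lambda> * (dist p p' + dist p p')"
    using dist_fst_le[of p p'] dist_snd_le[of p p'] \<Lambda>_nonneg
    by (intro mult_left_mono add_mono) (auto simp: dist_real_def)
  finally show "dist (case p of (x, y) \<Rightarrow> g x y) (case p' of (x, y) \<Rightarrow> g x y) \<le> 2 * \<Lambda> * dist p p'"
    by (simp add: case_prod_unfold dist_real_def)
qed (simp add: \<Lambda>_nonneg)

lemma swap: "lipschitz_on_rectangle B A \<Lambda> \<Gamma> (\<lambda>x y. g y x)"
proof
  fix x x' y y' :: real
  assume "x \<in> {0..B}" "x' \<in> {0..B}" "y \<in> {0..A}" "y' \<in> {0..A}"
  from lip[OF this(3,4,1,2)] show "\<bar>g y' x' - g y x\<bar> \<le> \<Lambda> * (\<bar>x' - x\<bar> + \<bar>y' - y\<bar>)"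
    by (simp add: add.commute)
qed (use \<Lambda>_nonneg bound in auto)

lemma goursat_defect_lipschitz_left:
  assumes \<beta>: "0 \<le> \<beta>\<^sub>1" "0 \<le> \<beta>\<^sub>2" and X: "X \<in> {0..A}" "X' \<in> {0..A}" "X \<le> X'" and Y: "Y \<in> {0..B}"
  shows "\<bar>goursat_defect \<beta>\<^sub>1 \<beta>\<^sub>2 g X' Y - goursat_defect \<beta>\<^sub>1 \<beta>\<^sub>2 g X Y\<bar>
    \<le> (2 * \<Lambda> + \<beta>\<^sub>2 * B * \<Lambda> + 2 * \<Gamma> * \<beta>\<^sub>1) * (X' - X)"
proof -
  have 0: "0 \<in> {0..A}" "0 \<in> {0..B}" using X Y by auto
  note ints = integrable_on_slices[OF continuous X(1) Y] integrable_on_slices[OF continuous X(2) Y]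
  have \<Gamma>: "0 \<le> \<Gamma>" using bound[OF 0] by linarith
  have "norm (integral (cbox 0 Y) (\<lambda>y. g X' y - g X y)) \<le> (\<Lambda> * (X' - X)) * measure lborel (cbox 0 Y)"
  proof (rule integrable_bound)
    show "norm (g X' y - g X y) \<le> \<Lambda> * (X' - X)" if "y \<in> cbox 0 Y" for y
      using lip[of X X' y y] X Y that by auto
  qed (use ints X \<Lambda>_nonneg in \<open>auto intro!: integrable_diff\<close>)
  also have "\<dots> \<le> (\<Lambda> * (X' - X)) * B"
    using Y X \<Lambda>_nonneg by (intro mult_left_mono) auto
  finally have 1: "\<bar>\<beta>\<^sub>2 * integral {0..Y} (\<lambda>y. g X' y - g X y)\<bar> \<le> \<beta>\<^sub>2 * (\<Lambda> * (X' - X) * B)"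
    using \<beta> by (simp add: abs_mult mult_left_mono)
  have eq1: "integral {0..Y} (\<lambda>y. g X' y - g 0 y) - integral {0..Y} (\<lambda>y. g X y - g 0 y) =
      integral {0..Y} (\<lambda>y. g X' y - g X y)"
    using ints X 0 by (simp add: integral_diff)
  have int: "(\<lambda>x. g x Y - g x 0) integrable_on {0..X'}"
    using ints Y 0 by (auto intro!: integrable_diff)
  then have int': "(\<lambda>x. g x Y - g x 0) integrable_on {X..X'}"
    using X by (auto intro: integrable_on_subinterval)
  have "norm (integral (cbox X X') (\<lambda>x. g x Y - g x 0)) \<le> (2 * \<Gamma>) * measure lborel (cbox X X')"
  proof (rule integrable_bound)
    show "norm (g x Y - g x 0) \<le> 2 * \<Gamma>" if "x \<in> cbox X X'" for x
      using bound[of x Y] bound[of x 0] X Y 0 that by auto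
  qed (use int' \<Gamma> in auto)
  then have 2: "\<bar>\<beta>\<^sub>1 * integral {X..X'} (\<lambda>x. g x Y - g x 0)\<bar> \<le> \<beta>\<^sub>1 * ((2 * \<Gamma>) * (X' - X))"
    using \<beta> X by (simp add: abs_mult mult_left_mono)
  have eq2: "integral {0..X'} (\<lambda>x. g x Y - g x 0) =
      integral {0..X} (\<lambda>x. g x Y - g x 0) + integral {X..X'} (\<lambda>x. g x Y - g x 0)"
    using Henstock_Kurzweil_Integration.integral_combine[OF _ X(3) int] X by simp
  have "goursat_defect \<beta>\<^sub>1 \<beta>\<^sub>2 g X' Y - goursat_defect \<beta>\<^sub>1 \<beta>\<^sub>2 g X Y =
     (g X' Y - g X Y) - (g X' 0 - g X 0)
     + \<beta>\<^sub>2 * integral {0..Y} (\<lambda>y. g X' y - g X y) + \<beta>\<^sub>1 * integral {X..X'} (\<lambda>x. g x Y - g x 0)"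
    unfolding goursat_defect_def eq1[symmetric] eq2 by (simp add: algebra_simps)
  moreover have "\<bar>g X' Y - g X Y\<bar> \<le> \<Lambda> * (X' - X)" "\<bar>g X' 0 - g X 0\<bar> \<le> \<Lambda> * (X' - X)"
    using lip[of X X' Y Y] lip[of X X' 0 0] X Y 0 by auto
  ultimately have "\<bar>goursat_defect \<beta>\<^sub>1 \<beta>\<^sub>2 g X' Y - goursat_defect \<beta>\<^sub>1 \<beta>\<^sub>2 g X Y\<bar>
      \<le> \<Lambda> * (X' - X) + \<Lambda> * (X' - X) + \<beta>\<^sub>2 * (\<Lambda> * (X' - X) * B) + \<beta>\<^sub>1 * ((2 * \<Gamma>) * (X' - X))"
    using 1 2 by linarith
  then show ?thesis by (simp add: algebra_simps)
qed

end

text \<open>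
  Exchanging the axes and the coefficients preserves the equation, so that the Lipschitz estimate in
  the second variable is an instance of the one in the first.
\<close>

lemma goursat_defect_swap:
  "goursat_defect \<beta>\<^sub>2 \<beta>\<^sub>1 (\<lambda>x y. g y x) Y X = goursat_defect \<beta>\<^sub>1 \<beta>\<^sub>2 g X Y"
  by (simp add: goursat_defect_def)

text \<open>
  A Lipschitz constant for the defect of a function that is \<open>\<Lambda>\<close>-Lipschitz and bounded by \<open>\<Gamma>\<close>.
\<close>

definition defect_modulus :: "real \<Rightarrow> real \<Rightarrow> real \<Rightarrow> real \<Rightarrow> real \<Rightarrow> real \<Rightarrow> real" where
  "defect_modulus \<beta>\<^sub>1 \<beta>\<^sub>2 A B \<Lambda> \<Gamma> = 2 * \<Lambda> + (\<beta>\<^sub>1 * A + \<beta>\<^sub>2 * B) * \<Lambda> + 2 * \<Gamma> * (\<beta>\<^sub>1 + \<beta>\<^sub>2)"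

context lipschitz_on_rectangle
begin

text \<open>
  Lets a finite grid of points control the defect everywhere.
\<close>

lemma goursat_defect_lipschitz:
  assumes \<beta>: "0 \<le> \<beta>\<^sub>1" "0 \<le> \<beta>\<^sub>2"
    and X: "X \<in> {0..A}" "X' \<in> {0..A}" and Y: "Y \<in> {0..B}" "Y' \<in> {0..B}"
  shows "\<bar>goursat_defect \<beta>\<^sub>1 \<beta>\<^sub>2 g X' Y' - goursat_defect \<beta>\<^sub>1 \<beta>\<^sub>2 g X Y\<bar>
    \<le> defect_modulus \<beta>\<^sub>1 \<beta>\<^sub>2 A B \<Lambda> \<Gamma> * (\<bar>X' - X\<bar> + \<bar>Y' - Y\<bar>)"
proof -
  let ?d = "goursat_defect \<beta>\<^sub>1 \<beta>\<^sub>2 g" and ?C = "defect_modulus \<beta>\<^sub>1 \<beta>\<^sub>2 A B \<Lambda> \<Gamma>"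
  interpret sw: lipschitz_on_rectangle B A \<Lambda> \<Gamma> "\<lambda>x y. g y x" by (rule swap)
  have \<Gamma>: "0 \<le> \<Gamma>" using bound[OF X(1) Y(1)] by linarith
  have AB: "0 \<le> A" "0 \<le> B" using X Y by auto
  have C: "2 * \<Lambda> + \<beta>\<^sub>2 * B * \<Lambda> + 2 * \<Gamma> * \<beta>\<^sub>1 \<le> ?C" "2 * \<Lambda> + \<beta>\<^sub>1 * A * \<Lambda> + 2 * \<Gamma> * \<beta>\<^sub>2 \<le> ?C"
    using \<Lambda>_nonneg \<Gamma> AB \<beta> by (auto simp: defect_modulus_def algebra_simps)
  have left: "\<bar>?d u' y - ?d u y\<bar> \<le> ?C * (u' - u)"
    if "u \<in> {0..A}" "u' \<in> {0..A}" "u \<le> u'" "y \<in> {0..B}" for u u' y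
    using that C(1) by (intro order_trans[OF goursat_defect_lipschitz_left[OF \<beta> that]] mult_right_mono) auto
  have right: "\<bar>?d x u' - ?d x u\<bar> \<le> ?C * (u' - u)"
    if "u \<in> {0..B}" "u' \<in> {0..B}" "u \<le> u'" "x \<in> {0..A}" for u u' x
    using that C(2)
    by (intro order_trans[OF sw.goursat_defect_lipschitz_left[OF \<beta>(2,1) that, unfolded goursat_defect_swap[where g = g]]]
        mult_right_mono) auto
  have "\<bar>?d X' Y' - ?d X Y'\<bar> \<le> ?C * \<bar>X' - X\<bar>"
    using left[of X X' Y'] left[of X' X Y'] X Y by (cases "X \<le> X'") auto
  moreover have "\<bar>?d X Y' - ?d X Y\<bar> \<le> ?C * \<bar>Y' - Y\<bar>"
    using right[of Y Y' X] right[of Y' Y X] X Y by (cases "Y \<le> Y'") auto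
  ultimately show ?thesis by (simp add: distrib_left)
qed

lemma goursat_defect_lattice:
  assumes \<beta>: "0 \<le> \<beta>\<^sub>1" "0 \<le> \<beta>\<^sub>2" and L: "L > 0" and ij: "real i / L \<le> A" "real j / L \<le> B"
  defines "F \<equiv> \<lambda>k l :: nat. g (real k / L) (real l / L)"
  shows "\<bar>goursat_defect \<beta>\<^sub>1 \<beta>\<^sub>2 g (real i / L) (real j / L) -
     (F i j - F i 0 - F 0 j + F 0 0
      + (1 - exp (- \<beta>\<^sub>2 / L)) * (\<Sum>y<j. F i y - F 0 y)
      + (1 - exp (- \<beta>\<^sub>1 / L)) * (\<Sum>x<i. F x j - F x 0))\<bar>
    \<le> (2 * \<Lambda> * (\<beta>\<^sub>1 * A + \<beta>\<^sub>2 * B) + 2 * \<Gamma> * (\<beta>\<^sub>1\<^sup>2 * A + \<beta>\<^sub>2\<^sup>2 * B)) / L"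
proof -
  have pos: "0 \<le> real i / L" "0 \<le> real j / L" using L by auto
  then have X: "real i / L \<in> {0..A}" and Y: "real j / L \<in> {0..B}" and 0: "0 \<in> {0..A}" "0 \<in> {0..B}"
    using ij by auto
  let ?X = "real i / L" and ?Y = "real j / L"
  have 1: "\<bar>\<beta>\<^sub>2 * integral {0..?Y} (\<lambda>y. g ?X y - g 0 y)
      - (1 - exp (- \<beta>\<^sub>2 / L)) * (\<Sum>k<j. g ?X (real k / L) - g 0 (real k / L))\<bar>
    \<le> (\<beta>\<^sub>2 * B * (2 * \<Lambda>) + \<beta>\<^sub>2\<^sup>2 * B * (2 * \<Gamma>)) / L"
  proof (rule damped_sum_error[OF L \<beta>(2) ij(2)])
    show "\<bar>(g ?X t - g 0 t) - (g ?X s - g 0 s)\<bar> \<le> 2 * \<Lambda> * (t - s)" if "0 \<le> s" "s \<le> t" "t \<le> B" for s t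
      using lip[of ?X ?X s t] lip[of 0 0 s t] X 0 that by auto
    show "\<bar>g ?X t - g 0 t\<bar> \<le> 2 * \<Gamma>" if "0 \<le> t" "t \<le> B" for t
      using bound[of ?X t] bound[of 0 t] X 0 that by auto
    show "continuous_on {0..B} (\<lambda>y. g ?X y - g 0 y)"
      using X 0 by (intro continuous_on_diff continuous_on_slices(1)[OF continuous])
  qed (use \<Lambda>_nonneg in auto)
  have 2: "\<bar>\<beta>\<^sub>1 * integral {0..?X} (\<lambda>x. g x ?Y - g x 0)
      - (1 - exp (- \<beta>\<^sub>1 / L)) * (\<Sum>k<i. g (real k / L) ?Y - g (real k / L) 0)\<bar>
    \<le> (\<beta>\<^sub>1 * A * (2 * \<Lambda>) + \<beta>\<^sub>1\<^sup>2 * A * (2 * \<Gamma>)) / L"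
  proof (rule damped_sum_error[OF L \<beta>(1) ij(1)])
    show "\<bar>(g t ?Y - g t 0) - (g s ?Y - g s 0)\<bar> \<le> 2 * \<Lambda> * (t - s)" if "0 \<le> s" "s \<le> t" "t \<le> A" for s t
      using lip[of s t ?Y ?Y] lip[of s t 0 0] Y 0 that by auto
    show "\<bar>g t ?Y - g t 0\<bar> \<le> 2 * \<Gamma>" if "0 \<le> t" "t \<le> A" for t
      using bound[of t ?Y] bound[of t 0] Y 0 that by auto
    show "continuous_on {0..A} (\<lambda>x. g x ?Y - g x 0)"
      using Y 0 by (intro continuous_on_diff continuous_on_slices(2)[OF continuous])
  qed (use \<Lambda>_nonneg in auto)
  have "\<bar>goursat_defect \<beta>\<^sub>1 \<beta>\<^sub>2 g ?X ?Y -
     (F i j - F i 0 - F 0 j + F 0 0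
      + (1 - exp (- \<beta>\<^sub>2 / L)) * (\<Sum>y<j. F i y - F 0 y)
      + (1 - exp (- \<beta>\<^sub>1 / L)) * (\<Sum>x<i. F x j - F x 0))\<bar>
    \<le> (\<beta>\<^sub>2 * B * (2 * \<Lambda>) + \<beta>\<^sub>2\<^sup>2 * B * (2 * \<Gamma>)) / L + (\<beta>\<^sub>1 * A * (2 * \<Lambda>) + \<beta>\<^sub>1\<^sup>2 * A * (2 * \<Gamma>)) / L"
    using 1 2 unfolding goursat_defect_def F_def by simp
  also have "\<dots> = (2 * \<Lambda> * (\<beta>\<^sub>1 * A + \<beta>\<^sub>2 * B) + 2 * \<Gamma> * (\<beta>\<^sub>1\<^sup>2 * A + \<beta>\<^sub>2\<^sup>2 * B)) / L"
    unfolding add_divide_distrib[symmetric] by (simp add: algebra_simps)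
  finally show ?thesis .
qed

end

lemma exp_lipschitz_below:
  fixes s t :: real
  assumes "s \<le> M" "t \<le> M"
  shows "\<bar>exp s - exp t\<bar> \<le> exp M * \<bar>s - t\<bar>"
proof -
  have *: "exp t - exp s \<le> exp M * (t - s)" if "s \<le> t" "t \<le> M" for s t
  proof -
    have "exp t - exp s = exp t * (1 - exp (s - t))" by (simp add: algebra_simps flip: exp_add)
    also have "\<dots> \<le> exp t * (t - s)"
    proof (rule mult_left_mono)
      show "1 - exp (s - t) \<le> t - s" using exp_ge_add_one_self[of "s - t"] by linarith
    qed simp
    also have "\<dots> \<le> exp M * (t - s)" using that by (intro mult_right_mono) auto
    finally show ?thesis .
  qed
  show ?thesis
  proof (cases "s \<le> t")
    case True
    then show ?thesis using *[OF True assms(2)] by (simp add: abs_if algebra_simps)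
  next
    case False
    then show ?thesis using *[of t s] assms by (simp add: abs_if algebra_simps)
  qed
qed

text \<open>
  The prelimit of \<open>exp (\<gamma> h)\<close>; at lattice points it is a power of \<open>q = exp (\<gamma> / L)\<close>,
  with the height as exponent.
\<close>

definition scaled_exp_height ::
  "real \<Rightarrow> real \<Rightarrow> (nat \<Rightarrow> bool) \<Rightarrow> (nat \<Rightarrow> bool) \<Rightarrow> (nat \<times> nat \<Rightarrow> bool \<times> bool) \<Rightarrow> real \<Rightarrow> real \<Rightarrow> real"
  where
  "scaled_exp_height \<gamma> L lft btm \<omega> x y = exp (\<gamma> * (height_xy lft btm \<omega> (L * x) (L * y) / L))"

lemma abs_scaled_height_le:
  assumes "L > 0" "0 \<le> x" "0 \<le> y"
  shows "\<bar>height_xy lft btm \<omega> (L * x) (L * y) / L\<bar> \<le> x + y"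
proof -
  have "height_xy lft btm \<omega> 0 0 = 0"
    using height_xy_of_nat[of lft btm \<omega> 0 0] by simp
  then have "\<bar>height_xy lft btm \<omega> (L * x) (L * y)\<bar> \<le> L * x + L * y"
    using height_xy_lipschitz[of 0 "L * x" 0 "L * y" lft btm \<omega>] assms by simp
  then show ?thesis using assms by (simp add: divide_le_eq algebra_simps)
qed

lemma abs_exponent_le:
  assumes "L > 0" "x \<in> {0..A}" "y \<in> {0..B}"
  shows "\<bar>\<gamma> * (height_xy lft btm \<omega> (L * x) (L * y) / L)\<bar> \<le> \<bar>\<gamma>\<bar> * (A + B)"
proof -
  have "\<bar>height_xy lft btm \<omega> (L * x) (L * y) / L\<bar> \<le> A + B"
    using abs_scaled_height_le[of L x y lft btm \<omega>] assms by auto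
  then show ?thesis unfolding abs_mult by (intro mult_left_mono) auto
qed

lemma scaled_exp_height_ge:
  assumes "L > 0" "x \<in> {0..A}" "y \<in> {0..B}"
  shows "exp (- \<bar>\<gamma>\<bar> * (A + B)) \<le> scaled_exp_height \<gamma> L lft btm \<omega> x y"
  unfolding scaled_exp_height_def exp_le_cancel_iff
  using abs_exponent_le[OF assms, of \<gamma> lft btm \<omega>] by linarith

lemma lipschitz_scaled_exp_height:
  fixes A B L \<gamma> :: real
  assumes L: "L > 0"
  defines "\<Gamma> \<equiv> exp (\<bar>\<gamma>\<bar> * (A + B))"
  shows "lipschitz_on_rectangle A B (\<bar>\<gamma>\<bar> * \<Gamma>) \<Gamma> (scaled_exp_height \<gamma> L lft btm \<omega>)"
proof
  fix x x' y y' assume xy: "x \<in> {0..A}" "x' \<in> {0..A}" "y \<in> {0..B}" "y' \<in> {0..B}"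
  let ?H = "\<lambda>x y. height_xy lft btm \<omega> (L * x) (L * y) / L"
  have "\<bar>?H x' y' - ?H x y\<bar> = \<bar>height_xy lft btm \<omega> (L * x') (L * y') - height_xy lft btm \<omega> (L * x) (L * y)\<bar> / L"
    using L by (simp flip: diff_divide_distrib)
  also have "\<dots> \<le> (\<bar>L * x' - L * x\<bar> + \<bar>L * y' - L * y\<bar>) / L"
    using L xy by (intro divide_right_mono height_xy_lipschitz) auto
  also have "\<dots> = \<bar>x' - x\<bar> + \<bar>y' - y\<bar>"
    using L by (simp add: abs_mult add_divide_distrib flip: right_diff_distrib)
  finally have H: "\<bar>?H x' y' - ?H x y\<bar> \<le> \<bar>x' - x\<bar> + \<bar>y' - y\<bar>" .
  have "\<bar>scaled_exp_height \<gamma> L lft btm \<omega> x' y' - scaled_exp_height \<gamma> L lft btm \<omega> x y\<bar>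
      \<le> \<Gamma> * \<bar>\<gamma> * ?H x' y' - \<gamma> * ?H x y\<bar>"
    unfolding scaled_exp_height_def \<Gamma>_def
    using abs_exponent_le[OF L xy(1,3), of \<gamma> lft btm \<omega>] abs_exponent_le[OF L xy(2,4), of \<gamma> lft btm \<omega>]
    by (intro exp_lipschitz_below) linarith+
  also have "\<dots> = \<Gamma> * (\<bar>\<gamma>\<bar> * \<bar>?H x' y' - ?H x y\<bar>)"
    by (simp only: abs_mult right_diff_distrib[symmetric])
  also have "\<dots> \<le> \<Gamma> * (\<bar>\<gamma>\<bar> * (\<bar>x' - x\<bar> + \<bar>y' - y\<bar>))"
    using H by (intro mult_left_mono) (auto simp: \<Gamma>_def)
  finally show "\<bar>scaled_exp_height \<gamma> L lft btm \<omega> x' y' - scaled_exp_height \<gamma> L lft btm \<omega> x y\<bar>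
      \<le> \<bar>\<gamma>\<bar> * \<Gamma> * (\<bar>x' - x\<bar> + \<bar>y' - y\<bar>)"
    by (simp add: ac_simps)
next
  fix x y assume "x \<in> {0..A}" "y \<in> {0..B}"
  then show "\<bar>scaled_exp_height \<gamma> L lft btm \<omega> x y\<bar> \<le> \<Gamma>"
    using abs_exponent_le[OF L, of x A y B \<gamma> lft btm \<omega>]
    unfolding scaled_exp_height_def \<Gamma>_def abs_exp_cancel exp_le_cancel_iff by linarith
qed (simp add: \<Gamma>_def)

lemma scaled_exp_height_lattice:
  assumes "L > 0"
  shows "scaled_exp_height \<gamma> L lft btm \<omega> (real i / L) (real j / L) = exp (\<gamma> / L) powi height lft btm \<omega> i j"
  using assms by (simp add: scaled_exp_height_def height_xy_of_nat exp_power_int mult.commute)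

text \<open>
  Rounding \<open>(X, Y)\<close> to the lattice changes the defect by order \<open>1 / L\<close>, and at a lattice point the
  summed four-point relation identifies the discretized defect with the accumulated noise.
\<close>

lemma goursat_defect_scaled_exp_height:
  fixes A B L \<gamma> :: real
  assumes \<beta>: "0 \<le> \<beta>\<^sub>1" "0 \<le> \<beta>\<^sub>2" and L: "L > 0" and b: "b = exp (- \<beta>\<^sub>1 / L)" "b * q = exp (- \<beta>\<^sub>2 / L)"
    and q: "q = exp (\<gamma> / L)"
    and X: "X \<in> {0..A}" and Y: "Y \<in> {0..B}"
  defines "\<Gamma> \<equiv> exp (\<bar>\<gamma>\<bar> * (A + B))"
  shows "\<bar>goursat_defect \<beta>\<^sub>1 \<beta>\<^sub>2 (scaled_exp_height \<gamma> L lft btm \<omega>) X Y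
      - noise_sum b q lft btm (nat \<lfloor>L * X\<rfloor>) (nat \<lfloor>L * Y\<rfloor>) \<omega>\<bar>
    \<le> (2 * defect_modulus \<beta>\<^sub>1 \<beta>\<^sub>2 A B (\<bar>\<gamma>\<bar> * \<Gamma>) \<Gamma>
        + 2 * (\<bar>\<gamma>\<bar> * \<Gamma>) * (\<beta>\<^sub>1 * A + \<beta>\<^sub>2 * B) + 2 * \<Gamma> * (\<beta>\<^sub>1\<^sup>2 * A + \<beta>\<^sub>2\<^sup>2 * B)) / L"
proof -
  interpret lipschitz_on_rectangle A B "\<bar>\<gamma>\<bar> * \<Gamma>" \<Gamma> "scaled_exp_height \<gamma> L lft btm \<omega>"
    unfolding \<Gamma>_def by (rule lipschitz_scaled_exp_height[OF L])
  let ?d = "goursat_defect \<beta>\<^sub>1 \<beta>\<^sub>2 (scaled_exp_height \<gamma> L lft btm \<omega>)"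
  let ?C = "defect_modulus \<beta>\<^sub>1 \<beta>\<^sub>2 A B (\<bar>\<gamma>\<bar> * \<Gamma>) \<Gamma>"
  let ?i = "nat \<lfloor>L * X\<rfloor>" and ?j = "nat \<lfloor>L * Y\<rfloor>"
  have floor: "0 \<le> Z - real (nat \<lfloor>L * Z\<rfloor>) / L" "Z - real (nat \<lfloor>L * Z\<rfloor>) / L \<le> 1 / L" if "0 \<le> Z" for Z
  proof -
    have "0 \<le> L * Z" using L that by simp
    then have "0 \<le> L * Z - real (nat \<lfloor>L * Z\<rfloor>)" "L * Z - real (nat \<lfloor>L * Z\<rfloor>) \<le> 1"
      by linarith+
    moreover have "Z - real (nat \<lfloor>L * Z\<rfloor>) / L = (L * Z - real (nat \<lfloor>L * Z\<rfloor>)) / L"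
      using L by (simp add: field_simps)
    ultimately show "0 \<le> Z - real (nat \<lfloor>L * Z\<rfloor>) / L" "Z - real (nat \<lfloor>L * Z\<rfloor>) / L \<le> 1 / L"
      using L by (auto intro: divide_right_mono)
  qed
  have i: "real ?i / L \<in> {0..A}" and j: "real ?j / L \<in> {0..B}"
    using floor[of X] floor[of Y] X Y L by auto
  have C: "0 \<le> ?C"
    using \<beta> X Y by (simp add: defect_modulus_def \<Gamma>_def)
  have "\<bar>?d X Y - ?d (real ?i / L) (real ?j / L)\<bar> \<le> ?C * (\<bar>X - real ?i / L\<bar> + \<bar>Y - real ?j / L\<bar>)"
    by (rule goursat_defect_lipschitz[OF \<beta> i X j Y])
  also have "\<dots> \<le> ?C * (1 / L + 1 / L)"
    using floor[of X] floor[of Y] X Y C by (intro mult_left_mono add_mono) auto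
  finally have 1: "\<bar>?d X Y - ?d (real ?i / L) (real ?j / L)\<bar> \<le> 2 * ?C / L" by (simp add: mult.commute)
  have 2: "\<bar>?d (real ?i / L) (real ?j / L) - noise_sum b q lft btm ?i ?j \<omega>\<bar>
    \<le> (2 * (\<bar>\<gamma>\<bar> * \<Gamma>) * (\<beta>\<^sub>1 * A + \<beta>\<^sub>2 * B) + 2 * \<Gamma> * (\<beta>\<^sub>1\<^sup>2 * A + \<beta>\<^sub>2\<^sup>2 * B)) / L"
    using goursat_defect_lattice[OF \<beta> L, of ?i ?j] i j
    unfolding noise_sum_eq scaled_exp_height_lattice[OF L] b(2) unfolding b(1) q by simp
  show ?thesis
    using 1 2 unfolding add_divide_distrib by linarith
qed

section \<open>The law of large numbers\<close>

text \<open>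
  The factor \<open>L\<^sup>2\<close> counts vertices, while each of the two summands is of order \<open>L\<close> to the power \<open>-3\<close>.
\<close>

lemma scaled_noise_variance_tendsto_0:
  fixes \<beta>\<^sub>1 \<beta>\<^sub>2 \<gamma> :: real
  assumes "\<beta>\<^sub>1 > 0" "\<beta>\<^sub>2 > 0" "\<gamma> \<noteq> 0"
  shows "((\<lambda>L. L\<^sup>2 * ((1 - exp (- \<beta>\<^sub>1 / L)) * (exp (\<gamma> / L) - 1)\<^sup>2
      + (1 - exp (- \<beta>\<^sub>2 / L)) * (inverse (exp (\<gamma> / L)) - 1)\<^sup>2)) \<longlongrightarrow> 0) at_top"
  using assms by (cases "\<gamma> > 0") real_asymp+

lemma height_xy_rescaled_determined:
  assumes "0 \<le> L" "L * A < real N" "L * B < real N"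
    and "x \<in> {0..A}" "y \<in> {0..B}" and "\<And>i j. i \<le> N \<Longrightarrow> j \<le> N \<Longrightarrow> \<omega> (i, j) = \<omega>' (i, j)"
  shows "height_xy lft btm \<omega> (L * x) (L * y) = height_xy lft btm \<omega>' (L * x) (L * y)"
proof (rule height_xy_determined)
  have "L * x \<le> L * A" "L * y \<le> L * B" using assms by (auto intro!: mult_left_mono)
  then show "L * x < real N" "L * y < real N" using assms by linarith+
qed (use assms in auto)

lemma obtain_box_size:
  fixes a b :: real
  obtains N :: nat where "a < real N" "b < real N"
proof -
  obtain N where "max a b < real N" using reals_Archimedean2 by blast
  then show thesis using that by auto
qed

lemma measurable_goursat_defect:
  assumes "L > 0" "X \<in> {0..A}" "Y \<in> {0..B}"
  shows "(\<lambda>\<omega>. goursat_defect \<beta>\<^sub>1 \<beta>\<^sub>2 (scaled_exp_height \<gamma> L lft btm \<omega>) X Y)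
    \<in> borel_measurable (six_vertex_space b q)"
proof -
  obtain N where N: "L * A < real N" "L * B < real N" by (rule obtain_box_size)
  have "determined_by ({..N} \<times> {..N})
    (\<lambda>\<omega>. goursat_defect \<beta>\<^sub>1 \<beta>\<^sub>2 (scaled_exp_height \<gamma> L lft btm \<omega>) X Y)"
    unfolding determined_by_def
  proof (intro allI impI)
    fix \<omega> \<omega>' :: "nat \<times> nat \<Rightarrow> bool \<times> bool" assume "\<forall>s\<in>{..N} \<times> {..N}. \<omega> s = \<omega>' s"
    then have eq: "scaled_exp_height \<gamma> L lft btm \<omega> x y = scaled_exp_height \<gamma> L lft btm \<omega>' x y"
      if "x \<in> {0..A}" "y \<in> {0..B}" for x y
      using that N assms height_xy_rescaled_determined[of L A N B x y \<omega> \<omega>' lft btm]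
      by (simp add: scaled_exp_height_def)
    show "goursat_defect \<beta>\<^sub>1 \<beta>\<^sub>2 (scaled_exp_height \<gamma> L lft btm \<omega>) X Y =
        goursat_defect \<beta>\<^sub>1 \<beta>\<^sub>2 (scaled_exp_height \<gamma> L lft btm \<omega>') X Y"
      unfolding goursat_defect_def using assms
      by (intro arg_cong2[where f = "(+)"] arg_cong2[where f = "(-)"] arg_cong2[where f = "(*)"]
          integral_cong eq refl) auto
  qed
  then show ?thesis by (intro measurable_determined_by[of "{..N} \<times> {..N}"]) auto
qed

lemma measurable_SUP_height:
  assumes "L > 0"
  shows "(\<lambda>\<omega>. SUP (x, y)\<in>{0..A} \<times> {0..B}. \<bar>height_xy lft btm \<omega> (L * x) (L * y) / L - h x y\<bar>)
    \<in> borel_measurable (six_vertex_space b q)"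
proof -
  obtain N where N: "L * A < real N" "L * B < real N" by (rule obtain_box_size)
  have "determined_by ({..N} \<times> {..N})
    (\<lambda>\<omega>. SUP (x, y)\<in>{0..A} \<times> {0..B}. \<bar>height_xy lft btm \<omega> (L * x) (L * y) / L - h x y\<bar>)"
    unfolding determined_by_def
  proof (intro allI impI)
    fix \<omega> \<omega>' :: "nat \<times> nat \<Rightarrow> bool \<times> bool" assume "\<forall>s\<in>{..N} \<times> {..N}. \<omega> s = \<omega>' s"
    then have eq: "height_xy lft btm \<omega> (L * x) (L * y) = height_xy lft btm \<omega>' (L * x) (L * y)"
      if "x \<in> {0..A}" "y \<in> {0..B}" for x y
      using that N assms height_xy_rescaled_determined[of L A N B x y \<omega> \<omega>' lft btm] by simp
    show "(SUP (x, y)\<in>{0..A} \<times> {0..B}. \<bar>height_xy lft btm \<omega> (L * x) (L * y) / L - h x y\<bar>) =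
        (SUP (x, y)\<in>{0..A} \<times> {0..B}. \<bar>height_xy lft btm \<omega>' (L * x) (L * y) / L - h x y\<bar>)"
      by (intro SUP_cong refl) (auto simp: eq)
  qed
  then show ?thesis by (intro measurable_determined_by[of "{..N} \<times> {..N}"]) auto
qed

text \<open>
  The weakly asymmetric scaling of the parameters. Smallness of the defect is a matter of the
  dynamics at the vertices and is proved for arbitrary boundary conditions.
\<close>

locale six_vertex_scaling =
  fixes \<beta>\<^sub>1 \<beta>\<^sub>2 A B \<gamma> :: real and b q :: "real \<Rightarrow> real" and lft btm :: "real \<Rightarrow> nat \<Rightarrow> bool"
  assumes \<beta>: "0 < \<beta>\<^sub>1" "0 < \<beta>\<^sub>2" and \<gamma>: "\<gamma> = \<beta>\<^sub>1 - \<beta>\<^sub>2" "\<gamma> \<noteq> 0"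
    and AB: "0 < A" "0 < B"
    and b: "\<And>L. L > 0 \<Longrightarrow> b L = exp (- \<beta>\<^sub>1 / L)"
    and qb: "\<And>L. L > 0 \<Longrightarrow> q L * b L = exp (- \<beta>\<^sub>2 / L)"
begin

abbreviation "P L \<equiv> six_vertex_space (b L) (q L)"

abbreviation "g L \<omega> \<equiv> scaled_exp_height \<gamma> L (lft L) (btm L) \<omega>"

abbreviation "\<Gamma> \<equiv> exp (\<bar>\<gamma>\<bar> * (A + B))"

lemma q: "L > 0 \<Longrightarrow> q L = exp (\<gamma> / L)"
proof -
  assume L: "L > 0"
  have "q L * exp (- \<beta>\<^sub>1 / L) = exp (\<gamma> / L) * exp (- \<beta>\<^sub>1 / L)"
    using b[OF L] qb[OF L] by (simp add: \<gamma>(1) diff_divide_distrib flip: exp_add)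
  then show ?thesis by simp
qed

lemma parameters:
  assumes "L > 0"
  shows "0 \<le> b L" "b L \<le> 1" "0 < q L" "b L * q L \<le> 1"
  using assms b[OF assms] qb[OF assms] q[OF assms] \<beta> by (simp_all add: mult.commute)

lemma noise_sum_second_moment_le:
  assumes L: "L > 0" and XY: "X \<in> {0..A}" "Y \<in> {0..B}"
  shows "(\<integral>\<omega>. (noise_sum (b L) (q L) (lft L) (btm L) (nat \<lfloor>L * X\<rfloor>) (nat \<lfloor>L * Y\<rfloor>) \<omega>)\<^sup>2 \<partial>P L)
    \<le> A * B * \<Gamma>\<^sup>2 * (L\<^sup>2 * noise_variance (b L) (q L))"
proof -
  let ?i = "nat \<lfloor>L * X\<rfloor>" and ?j = "nat \<lfloor>L * Y\<rfloor>"
  have "0 \<le> L * X" "L * X \<le> L * A" "0 \<le> L * Y" "L * Y \<le> L * B"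
    using L XY by (auto intro: mult_left_mono)
  then have ij: "real ?i \<le> L * A" "real ?j \<le> L * B" by linarith+
  have v0: "0 \<le> noise_variance (b L) (q L)"
    using parameters[OF L] by (simp add: noise_variance_def)
  have "(\<integral>\<omega>. (noise_sum (b L) (q L) (lft L) (btm L) ?i ?j \<omega>)\<^sup>2 \<partial>P L)
      \<le> real ?i * real ?j * (\<Gamma>\<^sup>2 * noise_variance (b L) (q L))"
  proof (rule noise_sum_second_moment[OF parameters[OF L]])
    fix x y \<omega> assume xy: "x < ?i" "y < ?j"
    then have "real x \<le> L * A" "real y \<le> L * B" using ij by linarith+
    then have "real x / L \<in> {0..A}" "real y / L \<in> {0..B}"
      using L by (auto simp: divide_le_eq mult.commute)
    then have "\<bar>scaled_exp_height \<gamma> L (lft L) (btm L) \<omega> (real x / L) (real y / L)\<bar> \<le> \<Gamma>"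
      by (rule lipschitz_on_rectangle.bound[OF lipschitz_scaled_exp_height[OF L]])
    then show "q L powi height (lft L) (btm L) \<omega> x y \<le> \<Gamma>"
      unfolding scaled_exp_height_lattice[OF L] q[OF L] by linarith
  qed
  also have "\<dots> \<le> (L * A) * (L * B) * (\<Gamma>\<^sup>2 * noise_variance (b L) (q L))"
    using ij L AB v0 by (intro mult_right_mono mult_mono) auto
  finally show ?thesis by (simp add: power2_eq_square ac_simps)
qed

lemma noise_variance_tendsto_0: "((\<lambda>L. L\<^sup>2 * noise_variance (b L) (q L)) \<longlongrightarrow> 0) at_top"
proof (rule Lim_transform_eventually[OF scaled_noise_variance_tendsto_0[OF \<beta> \<gamma>(2)]])
  show "\<forall>\<^sub>F L in at_top. L\<^sup>2 * ((1 - exp (- \<beta>\<^sub>1 / L)) * (exp (\<gamma> / L) - 1)\<^sup>2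
      + (1 - exp (- \<beta>\<^sub>2 / L)) * (inverse (exp (\<gamma> / L)) - 1)\<^sup>2) = L\<^sup>2 * noise_variance (b L) (q L)"
    using eventually_gt_at_top[of 0]
  proof eventually_elim
    case (elim L)
    have "b L * q L = exp (- \<beta>\<^sub>2 / L)" using qb[OF elim] by (simp only: mult.commute)
    then show ?case
      unfolding noise_variance_def q[OF elim, symmetric] b[OF elim, symmetric] by simp
  qed
qed

text \<open>
  Chebyshev's inequality for the accumulated noise. Half of the tolerance \<open>\<eta>\<close> absorbs the deterministic
  discretization error.
\<close>

lemma defect_at_point_tendsto_0:
  assumes \<eta>: "\<eta> > 0" and XY: "X \<in> {0..A}" "Y \<in> {0..B}"
  shows "((\<lambda>L. measure (P L) {\<omega>. \<bar>goursat_defect \<beta>\<^sub>1 \<beta>\<^sub>2 (g L \<omega>) X Y\<bar> > \<eta>}) \<longlongrightarrow> 0) at_top"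
proof -
  define C where "C = 2 * defect_modulus \<beta>\<^sub>1 \<beta>\<^sub>2 A B (\<bar>\<gamma>\<bar> * \<Gamma>) \<Gamma>
        + 2 * (\<bar>\<gamma>\<bar> * \<Gamma>) * (\<beta>\<^sub>1 * A + \<beta>\<^sub>2 * B) + 2 * \<Gamma> * (\<beta>\<^sub>1\<^sup>2 * A + \<beta>\<^sub>2\<^sup>2 * B)"
  define K where "K = A * B * \<Gamma>\<^sup>2 / (\<eta> / 2)\<^sup>2"
  have "((\<lambda>L. K * (L\<^sup>2 * noise_variance (b L) (q L))) \<longlongrightarrow> K * 0) at_top"
    by (intro tendsto_mult tendsto_const noise_variance_tendsto_0)
  then have lim: "((\<lambda>L. K * (L\<^sup>2 * noise_variance (b L) (q L))) \<longlongrightarrow> 0) at_top" by simp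
  have "((\<lambda>L. C / L) \<longlongrightarrow> 0) at_top"
    by (intro tendsto_divide_0[OF tendsto_const] filterlim_at_top_imp_at_infinity filterlim_ident)
  then have ev: "\<forall>\<^sub>F L in at_top. C / L < \<eta> / 2"
    by (rule order_tendstoD) (use \<eta> in simp)
  show ?thesis
  proof (rule tendsto_sandwich[OF _ _ tendsto_const lim])
    show "\<forall>\<^sub>F L in at_top. measure (P L) {\<omega>. \<bar>goursat_defect \<beta>\<^sub>1 \<beta>\<^sub>2 (g L \<omega>) X Y\<bar> > \<eta>}
        \<le> K * (L\<^sup>2 * noise_variance (b L) (q L))"
      using ev eventually_gt_at_top[of 0]
    proof eventually_elim
      case (elim L)
      note L = elim(2)
      interpret prob_space "P L" by (rule prob_space_six_vertex_space)
      define S where "S = noise_sum (b L) (q L) (lft L) (btm L) (nat \<lfloor>L * X\<rfloor>) (nat \<lfloor>L * Y\<rfloor>)"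
      have det: "determined_by ({..nat \<lfloor>L * X\<rfloor>} \<times> {..nat \<lfloor>L * Y\<rfloor>}) S"
        unfolding S_def by (rule determined_by_noise_sum)
      have meas [measurable]: "S \<in> borel_measurable (P L)"
        by (rule measurable_determined_by[OF _ det]) auto
      have det2: "determined_by ({..nat \<lfloor>L * X\<rfloor>} \<times> {..nat \<lfloor>L * Y\<rfloor>}) (\<lambda>\<omega>. (S \<omega>)\<^sup>2)"
        using det unfolding determined_by_def by metis
      have "{\<omega>. \<bar>goursat_defect \<beta>\<^sub>1 \<beta>\<^sub>2 (g L \<omega>) X Y\<bar> > \<eta>} \<subseteq> {\<omega> \<in> space (P L). \<bar>S \<omega>\<bar> \<ge> \<eta> / 2}"
      proof safe
        fix \<omega> assume "\<eta> < \<bar>goursat_defect \<beta>\<^sub>1 \<beta>\<^sub>2 (g L \<omega>) X Y\<bar>"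
        moreover have "\<bar>goursat_defect \<beta>\<^sub>1 \<beta>\<^sub>2 (g L \<omega>) X Y - S \<omega>\<bar> \<le> C / L"
          unfolding S_def C_def using \<beta> L XY b[OF L] qb[OF L] q[OF L]
          by (intro goursat_defect_scaled_exp_height) (auto simp: mult.commute)
        ultimately show "\<eta> / 2 \<le> \<bar>S \<omega>\<bar>" using elim(1) by linarith
      qed simp
      then have "measure (P L) {\<omega>. \<bar>goursat_defect \<beta>\<^sub>1 \<beta>\<^sub>2 (g L \<omega>) X Y\<bar> > \<eta>}
          \<le> measure (P L) {\<omega> \<in> space (P L). \<bar>S \<omega>\<bar> \<ge> \<eta> / 2}"
        by (intro finite_measure_mono) measurable
      also have "\<dots> \<le> (\<integral>\<omega>. (S \<omega>)\<^sup>2 \<partial>P L) / (\<eta> / 2)\<^sup>2"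
        using \<eta> by (intro second_moment_method integrable_determined_by[OF _ det2]) auto
      also have "\<dots> \<le> A * B * \<Gamma>\<^sup>2 * (L\<^sup>2 * noise_variance (b L) (q L)) / (\<eta> / 2)\<^sup>2"
        unfolding S_def by (intro divide_right_mono noise_sum_second_moment_le[OF L XY]) auto
      finally show ?case by (simp add: K_def)
    qed
  qed simp
qed

text \<open>
  A union bound over all vertices is out of reach of Chebyshev's inequality, since there are of
  order \<open>L\<^sup>2\<close> of them and its bound at one point decays only like \<open>1 / L\<close>.
  A grid that does not depend on \<open>L\<close> suffices because of the uniform Lipschitz bound on the defect.
\<close>

lemma defect_uniformly_small:
  assumes \<eta>: "\<eta> > 0"
  obtains Bad where "\<And>L. L > 0 \<Longrightarrow> Bad L \<in> sets (P L)"
    and "((\<lambda>L. measure (P L) (Bad L)) \<longlongrightarrow> 0) at_top"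
    and "\<And>L \<omega> X Y. \<lbrakk>L > 0; \<omega> \<notin> Bad L; X \<in> {0..A}; Y \<in> {0..B}\<rbrakk> \<Longrightarrow>
      \<bar>goursat_defect \<beta>\<^sub>1 \<beta>\<^sub>2 (g L \<omega>) X Y\<bar> \<le> \<eta>"
proof -
  define C where "C = defect_modulus \<beta>\<^sub>1 \<beta>\<^sub>2 A B (\<bar>\<gamma>\<bar> * \<Gamma>) \<Gamma>"
  have C: "0 \<le> C"
    using \<beta> AB by (simp add: C_def defect_modulus_def)
  \<comment> \<open>The grid is so fine that the defect varies by at most \<open>\<eta> / 2\<close> between neighbouring nodes.\<close>
  obtain N :: nat where N: "C * (A + B) / (\<eta> / 2) < real N" using reals_Archimedean2 by blast
  have "0 \<le> C * (A + B) / (\<eta> / 2)" using C AB \<eta> by simp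
  with N have N0: "0 < real N" by linarith
  have CN: "C * (A / N + B / N) \<le> \<eta> / 2"
    using N N0 \<eta> by (simp add: field_simps)
  define node where "node = (\<lambda>a (k :: nat). a * real k / real N)"
  have node_in: "node a k \<in> {0..a}" if "k \<le> N" "0 < a" for a k
    using that N0 by (auto simp: node_def divide_le_eq)
  have near: "\<exists>k\<le>N. \<bar>z - node a k\<bar> \<le> a / N" if "z \<in> {0..a}" "0 < a" for a z
  proof (intro exI conjI)
    let ?t = "z * real N / a"
    have "0 \<le> ?t" "?t \<le> real N" using that N0 by (auto simp: divide_le_eq mult.commute)
    then show "nat \<lfloor>?t\<rfloor> \<le> N" by linarith
    have "\<bar>?t - real (nat \<lfloor>?t\<rfloor>)\<bar> \<le> 1" using \<open>0 \<le> ?t\<close> by linarith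
    then have "a / N * \<bar>?t - real (nat \<lfloor>?t\<rfloor>)\<bar> \<le> a / N * 1"
      using that N0 by (intro mult_left_mono) auto
    moreover have "z - node a (nat \<lfloor>?t\<rfloor>) = a / N * (?t - real (nat \<lfloor>?t\<rfloor>))"
      using that N0 by (simp add: node_def right_diff_distrib)
    ultimately show "\<bar>z - node a (nat \<lfloor>?t\<rfloor>)\<bar> \<le> a / N"
      using that N0 by (simp add: abs_mult)
  qed
  define E where "E = (\<lambda>L (p :: nat \<times> nat).
    {\<omega>. \<bar>goursat_defect \<beta>\<^sub>1 \<beta>\<^sub>2 (g L \<omega>) (node A (fst p)) (node B (snd p))\<bar> > \<eta> / 2})"
  define Bad where "Bad = (\<lambda>L. \<Union>p\<in>{..N} \<times> {..N}. E L p)"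
  have E_sets: "E L p \<in> sets (P L)" if "L > 0" "p \<in> {..N} \<times> {..N}" for L p
  proof -
    have [measurable]: "(\<lambda>\<omega>. goursat_defect \<beta>\<^sub>1 \<beta>\<^sub>2 (g L \<omega>) (node A (fst p)) (node B (snd p)))
        \<in> borel_measurable (P L)"
      using that node_in AB by (intro measurable_goursat_defect[of L _ A _ B]) auto
    have "{\<omega> \<in> space (P L). \<bar>goursat_defect \<beta>\<^sub>1 \<beta>\<^sub>2 (g L \<omega>) (node A (fst p)) (node B (snd p))\<bar> > \<eta> / 2}
        \<in> sets (P L)"
      by measurable
    then show ?thesis by (simp add: E_def)
  qed
  show thesis
  proof (rule that)
    show "Bad L \<in> sets (P L)" if "L > 0" for L
      unfolding Bad_def using E_sets[OF that] by (intro sets.finite_UN) auto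
    have "((\<lambda>L. measure (P L) (E L p)) \<longlongrightarrow> 0) at_top" if "p \<in> {..N} \<times> {..N}" for p
      unfolding E_def using \<eta> that node_in AB by (intro defect_at_point_tendsto_0) auto
    then have lim: "((\<lambda>L. \<Sum>p\<in>{..N} \<times> {..N}. measure (P L) (E L p)) \<longlongrightarrow> 0) at_top"
      by (rule tendsto_null_sum)
    show "((\<lambda>L. measure (P L) (Bad L)) \<longlongrightarrow> 0) at_top"
    proof (rule tendsto_sandwich[OF _ _ tendsto_const lim])
      show "\<forall>\<^sub>F L in at_top. measure (P L) (Bad L) \<le> (\<Sum>p\<in>{..N} \<times> {..N}. measure (P L) (E L p))"
        using eventually_gt_at_top[of 0]
      proof eventually_elim
        case (elim L)
        interpret prob_space "P L" by (rule prob_space_six_vertex_space)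
        show ?case
          unfolding Bad_def using E_sets[OF elim] by (intro finite_measure_subadditive_finite) auto
      qed
    qed simp
    fix L \<omega> X Y assume L: "L > 0" and good: "\<omega> \<notin> Bad L" and X: "X \<in> {0..A}" and Y: "Y \<in> {0..B}"
    obtain k where k: "k \<le> N" "\<bar>X - node A k\<bar> \<le> A / N" using near[OF X AB(1)] by blast
    obtain l where l: "l \<le> N" "\<bar>Y - node B l\<bar> \<le> B / N" using near[OF Y AB(2)] by blast
    interpret lipschitz_on_rectangle A B "\<bar>\<gamma>\<bar> * \<Gamma>" \<Gamma> "g L \<omega>"
      by (rule lipschitz_scaled_exp_height[OF L])
    have "\<bar>goursat_defect \<beta>\<^sub>1 \<beta>\<^sub>2 (g L \<omega>) X Y - goursat_defect \<beta>\<^sub>1 \<beta>\<^sub>2 (g L \<omega>) (node A k) (node B l)\<bar>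
        \<le> C * (\<bar>X - node A k\<bar> + \<bar>Y - node B l\<bar>)"
      unfolding C_def using \<beta> X Y k l node_in AB
      by (intro goursat_defect_lipschitz) auto
    also have "\<dots> \<le> C * (A / N + B / N)"
      using k l C by (intro mult_left_mono add_mono) auto
    also note CN
    finally have "\<bar>goursat_defect \<beta>\<^sub>1 \<beta>\<^sub>2 (g L \<omega>) X Y
        - goursat_defect \<beta>\<^sub>1 \<beta>\<^sub>2 (g L \<omega>) (node A k) (node B l)\<bar> \<le> \<eta> / 2" .
    moreover have "\<bar>goursat_defect \<beta>\<^sub>1 \<beta>\<^sub>2 (g L \<omega>) (node A k) (node B l)\<bar> \<le> \<eta> / 2"
      using good k l by (force simp: Bad_def E_def)
    ultimately show "\<bar>goursat_defect \<beta>\<^sub>1 \<beta>\<^sub>2 (g L \<omega>) X Y\<bar> \<le> \<eta>" by linarith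
  qed
qed

end

locale six_vertex_boundary_limit = six_vertex_scaling +
  fixes chi psi :: "real \<Rightarrow> real"
  assumes chi: "\<And>\<omega>. uniform_limit {0..A}
       (\<lambda>L x. height_xy (lft L) (btm L) \<omega> (L * x) 0 / L) chi at_top"
    and psi: "\<And>\<omega>. uniform_limit {0..B}
       (\<lambda>L y. height_xy (lft L) (btm L) \<omega> 0 (L * y) / L) psi at_top"
begin

text \<open>
  The bound \<open>A + B + 1\<close> leaves room for a limit \<open>t\<close> about which nothing is known except that it is
  within distance 1 of a height.
\<close>

lemma exp_near:
  fixes s t :: real
  assumes "\<bar>s\<bar> \<le> A + B" "\<bar>s - t\<bar> < e" "e \<le> 1"
  shows "\<bar>exp (\<gamma> * s) - exp (\<gamma> * t)\<bar> \<le> exp (\<bar>\<gamma>\<bar> * (A + B + 1)) * \<bar>\<gamma>\<bar> * e"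
proof -
  have *: "\<gamma> * r \<le> \<bar>\<gamma>\<bar> * (A + B + 1)" if "\<bar>r\<bar> \<le> A + B + 1" for r
  proof -
    have "\<gamma> * r \<le> \<bar>\<gamma>\<bar> * \<bar>r\<bar>" by (metis abs_ge_self abs_mult)
    also have "\<dots> \<le> \<bar>\<gamma>\<bar> * (A + B + 1)" using that by (intro mult_left_mono) auto
    finally show ?thesis .
  qed
  have "\<bar>exp (\<gamma> * s) - exp (\<gamma> * t)\<bar> \<le> exp (\<bar>\<gamma>\<bar> * (A + B + 1)) * \<bar>\<gamma> * s - \<gamma> * t\<bar>"
    using assms by (intro exp_lipschitz_below *) linarith+
  also have "\<dots> = exp (\<bar>\<gamma>\<bar> * (A + B + 1)) * (\<bar>\<gamma>\<bar> * \<bar>s - t\<bar>)"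
    by (simp add: abs_mult flip: right_diff_distrib)
  also have "\<dots> \<le> exp (\<bar>\<gamma>\<bar> * (A + B + 1)) * (\<bar>\<gamma>\<bar> * e)"
    using assms by (intro mult_left_mono) auto
  finally show ?thesis by simp
qed

text \<open>
  On the axes the height is deterministic, so the closeness holds for all coins at once and the
  choice of \<open>undefined\<close> as a representative is immaterial.
\<close>

lemma boundary_values_close:
  assumes \<eta>: "\<eta> > 0"
  shows "\<forall>\<^sub>F L in at_top. \<forall>\<omega>. (\<forall>x\<in>{0..A}. \<bar>g L \<omega> x 0 - exp (\<gamma> * chi x)\<bar> \<le> \<eta>) \<and>
    (\<forall>y\<in>{0..B}. \<bar>g L \<omega> 0 y - exp (\<gamma> * psi y)\<bar> \<le> \<eta>)"
proof -
  define K where "K = exp (\<bar>\<gamma>\<bar> * (A + B + 1)) * \<bar>\<gamma>\<bar>"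
  define e where "e = min 1 (\<eta> / K)"
  have K: "K > 0" using \<gamma> by (simp add: K_def)
  then have e: "0 < e" "e \<le> 1" using \<eta> by (auto simp: e_def)
  have Ke: "K * e \<le> \<eta>" using K by (simp add: e_def min_def field_simps)
  have "\<forall>\<^sub>F L in at_top. \<forall>x\<in>{0..A}. dist (height_xy (lft L) (btm L) undefined (L * x) 0 / L) (chi x) < e"
    using chi[of undefined] e(1) by (rule uniform_limitD)
  moreover have "\<forall>\<^sub>F L in at_top. \<forall>y\<in>{0..B}. dist (height_xy (lft L) (btm L) undefined 0 (L * y) / L) (psi y) < e"
    using psi[of undefined] e(1) by (rule uniform_limitD)
  ultimately show ?thesis
    using eventually_gt_at_top[of 0]
  proof eventually_elim
    case (elim L)
    show ?case
    proof (intro allI conjI ballI)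
      fix \<omega> x assume x: "x \<in> {0..A}"
      have "\<bar>height_xy (lft L) (btm L) \<omega> (L * x) (L * 0) / L\<bar> \<le> x + 0"
        using x elim by (intro abs_scaled_height_le) auto
      moreover have "\<bar>height_xy (lft L) (btm L) \<omega> (L * x) (L * 0) / L - chi x\<bar> < e"
        using elim(1) x height_xy_axes_deterministic(1)[of "lft L" "btm L" \<omega> "L * x" undefined]
        by (simp add: dist_real_def)
      ultimately have "\<bar>g L \<omega> x 0 - exp (\<gamma> * chi x)\<bar> \<le> K * e"
        unfolding scaled_exp_height_def K_def using x AB e by (intro exp_near) auto
      then show "\<bar>g L \<omega> x 0 - exp (\<gamma> * chi x)\<bar> \<le> \<eta>" using Ke by linarith
    next
      fix \<omega> y assume y: "y \<in> {0..B}"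
      have "\<bar>height_xy (lft L) (btm L) \<omega> (L * 0) (L * y) / L\<bar> \<le> 0 + y"
        using y elim by (intro abs_scaled_height_le) auto
      moreover have "\<bar>height_xy (lft L) (btm L) \<omega> (L * 0) (L * y) / L - psi y\<bar> < e"
        using elim(2) y height_xy_axes_deterministic(2)[of "lft L" "btm L" \<omega> "L * y" undefined]
        by (simp add: dist_real_def)
      ultimately have "\<bar>g L \<omega> 0 y - exp (\<gamma> * psi y)\<bar> \<le> K * e"
        unfolding scaled_exp_height_def K_def using y AB e by (intro exp_near) auto
      then show "\<bar>g L \<omega> 0 y - exp (\<gamma> * psi y)\<bar> \<le> \<eta>" using Ke by linarith
    qed
  qed
qed

abbreviation "approx \<equiv> approx_solution \<beta>\<^sub>1 \<beta>\<^sub>2 A B (\<lambda>x. exp (\<gamma> * chi x)) (\<lambda>y. exp (\<gamma> * psi y))"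

lemma approx_solution_with_high_probability:
  assumes \<eta>: "\<eta> > 0"
  obtains Bad where "\<And>L. L > 0 \<Longrightarrow> Bad L \<in> sets (P L)"
    and "((\<lambda>L. measure (P L) (Bad L)) \<longlongrightarrow> 0) at_top"
    and "\<forall>\<^sub>F L in at_top. \<forall>\<omega>. \<omega> \<notin> Bad L \<longrightarrow> approx \<eta> (g L \<omega>)"
proof -
  obtain Bad where Bad: "\<And>L. L > 0 \<Longrightarrow> Bad L \<in> sets (P L)"
    "((\<lambda>L. measure (P L) (Bad L)) \<longlongrightarrow> 0) at_top"
    "\<And>L \<omega> X Y. \<lbrakk>L > 0; \<omega> \<notin> Bad L; X \<in> {0..A}; Y \<in> {0..B}\<rbrakk> \<Longrightarrow>
      \<bar>goursat_defect \<beta>\<^sub>1 \<beta>\<^sub>2 (g L \<omega>) X Y\<bar> \<le> \<eta>"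
    using defect_uniformly_small[OF \<eta>] by blast
  show thesis
  proof (rule that[OF Bad(1,2)])
    show "\<forall>\<^sub>F L in at_top. \<forall>\<omega>. \<omega> \<notin> Bad L \<longrightarrow> approx \<eta> (g L \<omega>)"
      using boundary_values_close[OF \<eta>] eventually_gt_at_top[of 0]
    proof eventually_elim
      case (elim L)
      show ?case
      proof (intro allI impI)
        fix \<omega> assume "\<omega> \<notin> Bad L"
        then show "approx \<eta> (g L \<omega>)"
          unfolding approx_solution_def
          using elim Bad(3)[of L \<omega>]
            lipschitz_on_rectangle.continuous[OF lipschitz_scaled_exp_height[OF elim(2)]]
          by blast
      qed
    qed
  qed
qed

text \<open>
  For large \<open>L\<close> the bad event has probability less than 1, so a realization outside it exists and
  is an approximate solution with the required lower bound.
\<close>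

lemma limit_solution:
  obtains f where "approx 0 f"
    and "\<And>x y. x \<in> {0..A} \<Longrightarrow> y \<in> {0..B} \<Longrightarrow> exp (- \<bar>\<gamma>\<bar> * (A + B)) \<le> f x y"
proof -
  have "\<exists>g. approx \<eta> g \<and> (\<forall>x\<in>{0..A}. \<forall>y\<in>{0..B}. exp (- \<bar>\<gamma>\<bar> * (A + B)) \<le> g x y)"
    if \<eta>: "\<eta> > 0" for \<eta> :: real
  proof -
    obtain Bad where Bad: "\<And>L. L > 0 \<Longrightarrow> Bad L \<in> sets (P L)"
      "((\<lambda>L. measure (P L) (Bad L)) \<longlongrightarrow> 0) at_top"
      "\<forall>\<^sub>F L in at_top. \<forall>\<omega>. \<omega> \<notin> Bad L \<longrightarrow> approx \<eta> (g L \<omega>)"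
      by (rule approx_solution_with_high_probability[OF \<eta>]) blast
    have "\<forall>\<^sub>F L in at_top. measure (P L) (Bad L) < 1"
      using Bad(2) by (rule order_tendstoD) simp
    with Bad(3) have "\<forall>\<^sub>F L in at_top. L > 0 \<and> measure (P L) (Bad L) < 1 \<and>
        (\<forall>\<omega>. \<omega> \<notin> Bad L \<longrightarrow> approx \<eta> (g L \<omega>))"
      using eventually_gt_at_top[of 0] by eventually_elim simp
    from eventually_happens'[OF trivial_limit_at_top_linorder this]
    obtain L where L: "L > 0" "measure (P L) (Bad L) < 1"
        "\<And>\<omega>. \<omega> \<notin> Bad L \<Longrightarrow> approx \<eta> (g L \<omega>)"
      by blast
    interpret prob_space "P L" by (rule prob_space_six_vertex_space)
    have "Bad L \<noteq> UNIV" using L(2) prob_space by auto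
    then obtain \<omega> where "\<omega> \<notin> Bad L" by auto
    from L(3)[OF this] scaled_exp_height_ge[OF L(1)]
    show "\<exists>g. approx \<eta> g \<and> (\<forall>x\<in>{0..A}. \<forall>y\<in>{0..B}. exp (- \<bar>\<gamma>\<bar> * (A + B)) \<le> g x y)"
      by blast
  qed
  then show thesis
    using AB by (intro solution_if_approx_solutions[OF \<beta> _ _ _ that]) auto
qed

lemma height_close_if_exp_close:
  assumes L: "L > 0" and x: "x \<in> {0..A}" and y: "y \<in> {0..B}"
    and f: "exp (- \<bar>\<gamma>\<bar> * (A + B)) \<le> f"
  shows "\<bar>height_xy (lft L) (btm L) \<omega> (L * x) (L * y) / L - ln f / \<gamma>\<bar>
    \<le> \<Gamma> / \<bar>\<gamma>\<bar> * \<bar>g L \<omega> x y - f\<bar>"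
proof -
  let ?c = "exp (- \<bar>\<gamma>\<bar> * (A + B))"
  have c: "?c > 0" by simp
  have ln_le: "ln s - ln t \<le> \<Gamma> * \<bar>s - t\<bar>" if "?c \<le> s" "?c \<le> t" for s t
  proof -
    have pos: "0 < s" "0 < t" using that c by linarith+
    have "ln s - ln t \<le> (s - t) / t" using pos by (rule ln_diff_le)
    also have "\<dots> \<le> \<bar>s - t\<bar> / ?c"
      using that pos c by (intro frac_le) auto
    also have "\<dots> = \<Gamma> * \<bar>s - t\<bar>" unfolding mult_minus_left exp_minus by (simp add: divide_inverse mult.commute)
    finally show ?thesis .
  qed
  have g: "?c \<le> g L \<omega> x y" by (rule scaled_exp_height_ge[OF L x y])
  have "\<bar>ln (g L \<omega> x y) - ln f\<bar> \<le> \<Gamma> * \<bar>g L \<omega> x y - f\<bar>"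
    using ln_le[OF g f] ln_le[OF f g] unfolding abs_minus_commute[of f] by (intro abs_leI) linarith+
  then have "\<bar>ln (g L \<omega> x y) - ln f\<bar> / \<bar>\<gamma>\<bar> \<le> \<Gamma> * \<bar>g L \<omega> x y - f\<bar> / \<bar>\<gamma>\<bar>"
    by (intro divide_right_mono) auto
  moreover have "height_xy (lft L) (btm L) \<omega> (L * x) (L * y) / L - ln f / \<gamma> = (ln (g L \<omega> x y) - ln f) / \<gamma>"
    using \<gamma>(2) by (simp add: scaled_exp_height_def diff_divide_distrib)
  ultimately show ?thesis by (simp add: abs_divide)
qed

text \<open>
  Outside the bad event the realization and the limit differ by at most a multiple of the error.
  Logarithms are Lipschitz above the common lower bound, so the same holds for the heights.
\<close>

lemma law_of_large_numbers:
  assumes f: "approx 0 f"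
    and pos: "\<And>x y. x \<in> {0..A} \<Longrightarrow> y \<in> {0..B} \<Longrightarrow> exp (- \<bar>\<gamma>\<bar> * (A + B)) \<le> f x y"
  shows "tendsto_0_in_probability P
     (\<lambda>L \<omega>. SUP (x, y)\<in>{0..A} \<times> {0..B}.
        \<bar>height_xy (lft L) (btm L) \<omega> (L * x) (L * y) / L - ln (f x y) / \<gamma>\<bar>) at_top"
  unfolding tendsto_0_in_probability_def
proof (intro conjI allI impI)
  let ?S = "\<lambda>L \<omega>. SUP (x, y)\<in>{0..A} \<times> {0..B}.
        \<bar>height_xy (lft L) (btm L) \<omega> (L * x) (L * y) / L - ln (f x y) / \<gamma>\<bar>"
  show "\<forall>\<^sub>F L in at_top. ?S L \<in> borel_measurable (P L)"
    using eventually_gt_at_top[of 0]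
    by eventually_elim (rule measurable_SUP_height)
  fix \<epsilon> :: real assume \<epsilon>: "\<epsilon> > 0"
  define C where "C = \<Gamma> / \<bar>\<gamma>\<bar> * stability_const \<beta>\<^sub>1 \<beta>\<^sub>2 A B"
  have C: "C > 0"
    using stability_const_pos[OF \<beta>, of A B] AB \<gamma>(2) by (simp add: C_def)
  have \<epsilon>C: "\<epsilon> / C > 0" using C \<epsilon> by simp
  obtain Bad where Bad: "\<And>L. L > 0 \<Longrightarrow> Bad L \<in> sets (P L)"
    "((\<lambda>L. measure (P L) (Bad L)) \<longlongrightarrow> 0) at_top"
    "\<forall>\<^sub>F L in at_top. \<forall>\<omega>. \<omega> \<notin> Bad L \<longrightarrow> approx (\<epsilon> / C) (g L \<omega>)"
    by (rule approx_solution_with_high_probability[OF \<epsilon>C]) blast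
  show "((\<lambda>L. measure (P L) {\<omega> \<in> space (P L). \<epsilon> < \<bar>?S L \<omega>\<bar>}) \<longlongrightarrow> 0) at_top"
  proof (rule tendsto_sandwich[OF _ _ tendsto_const Bad(2)])
    show "\<forall>\<^sub>F L in at_top. measure (P L) {\<omega> \<in> space (P L). \<epsilon> < \<bar>?S L \<omega>\<bar>} \<le> measure (P L) (Bad L)"
      using Bad(3) eventually_gt_at_top[of 0]
    proof eventually_elim
      case (elim L)
      interpret prob_space "P L" by (rule prob_space_six_vertex_space)
      have S_le: "\<bar>?S L \<omega>\<bar> \<le> \<epsilon>" if good: "\<omega> \<notin> Bad L" for \<omega>
      proof (rule cSup_abs_le)
        fix s assume "s \<in> (\<lambda>(x, y). \<bar>height_xy (lft L) (btm L) \<omega> (L * x) (L * y) / L - ln (f x y) / \<gamma>\<bar>)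
            ` ({0..A} \<times> {0..B})"
        then obtain x y where xy: "x \<in> {0..A}" "y \<in> {0..B}"
          and s: "s = \<bar>height_xy (lft L) (btm L) \<omega> (L * x) (L * y) / L - ln (f x y) / \<gamma>\<bar>"
          by auto
        have "s \<le> \<Gamma> / \<bar>\<gamma>\<bar> * \<bar>g L \<omega> x y - f x y\<bar>"
          unfolding s by (rule height_close_if_exp_close[OF elim(2) xy pos[OF xy]])
        also have "\<dots> \<le> \<Gamma> / \<bar>\<gamma>\<bar> * (stability_const \<beta>\<^sub>1 \<beta>\<^sub>2 A B * (\<epsilon> / C + 0))"
        proof (rule mult_left_mono)
          have "approx (\<epsilon> / C) (g L \<omega>)" using elim(1) good by blast
          then show "\<bar>g L \<omega> x y - f x y\<bar> \<le> stability_const \<beta>\<^sub>1 \<beta>\<^sub>2 A B * (\<epsilon> / C + 0)"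
            by (rule approx_solution_stability[OF \<beta> _ f xy])
        qed simp
        also have "\<dots> = C * (\<epsilon> / C)" by (simp add: C_def)
        also have "\<dots> = \<epsilon>" using C by simp
        finally show "\<bar>s\<bar> \<le> \<epsilon>" using s by simp
      qed (use AB in auto)
      have "{\<omega> \<in> space (P L). \<epsilon> < \<bar>?S L \<omega>\<bar>} \<subseteq> Bad L"
      proof (rule subsetI, rule ccontr)
        fix \<omega> assume "\<omega> \<in> {\<omega> \<in> space (P L). \<epsilon> < \<bar>?S L \<omega>\<bar>}" and "\<omega> \<notin> Bad L"
        with S_le[of \<omega>] show False by (simp only: mem_Collect_eq) linarith
      qed
      then show ?case by (rule finite_measure_mono[OF _ Bad(1)[OF elim(2)]])
    qed
  qed simp
qed

end

theorem theorem5p1: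
  fixes \<beta>\<^sub>1 \<beta>\<^sub>2 \<qq> A B :: real
    and chi psi b q :: "real \<Rightarrow> real"
    and lft btm :: "real \<Rightarrow> nat \<Rightarrow> bool"
  assumes "\<beta>\<^sub>1 > 0" and "\<beta>\<^sub>2 > 0" and "\<beta>\<^sub>1 \<noteq> \<beta>\<^sub>2"
    and "\<qq> = exp (\<beta>\<^sub>1 - \<beta>\<^sub>2)"
    and "A > 0" and "B > 0"
    and "1-lipschitz_on {0..A} chi" and "mono_on {0..A} chi \<or> antimono_on {0..A} chi"
    and "1-lipschitz_on {0..B} psi" and "mono_on {0..B} psi \<or> antimono_on {0..B} psi"
    and "chi 0 = psi 0"
    and "\<And>L. L > 0 \<Longrightarrow> b L = exp (- \<beta>\<^sub>1 / L)"
    and "\<And>L. L > 0 \<Longrightarrow> q L * b L = exp (- \<beta>\<^sub>2 / L)"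
    and "\<And>\<omega>. uniform_limit {0..A}
               (\<lambda>L x. height_xy (lft L) (btm L) \<omega> (L * x) 0 / L) chi at_top"
    and "\<And>\<omega>. uniform_limit {0..B}
               (\<lambda>L y. height_xy (lft L) (btm L) \<omega> 0 (L * y) / L) psi at_top"
  shows "\<exists>h :: real \<Rightarrow> real \<Rightarrow> real.
     integrated_pde_solution \<beta>\<^sub>1 \<beta>\<^sub>2 A B (\<lambda>x. \<qq> powr chi x) (\<lambda>y. \<qq> powr psi y) (\<lambda>x y. \<qq> powr h x y) \<and>
     (\<forall>f. integrated_pde_solution \<beta>\<^sub>1 \<beta>\<^sub>2 A B (\<lambda>x. \<qq> powr chi x) (\<lambda>y. \<qq> powr psi y) f \<longrightarrow>
          (\<forall>x\<in>{0..A}. \<forall>y\<in>{0..B}. f x y = \<qq> powr h x y)) \<and>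
     tendsto_0_in_probability (\<lambda>L. six_vertex_space (b L) (q L))
       (\<lambda>L \<omega>. SUP (x, y)\<in>{0..A} \<times> {0..B}.
          \<bar>height_xy (lft L) (btm L) \<omega> (L * x) (L * y) / L - h x y\<bar>)
       at_top"
proof -
  define \<gamma> where "\<gamma> = \<beta>\<^sub>1 - \<beta>\<^sub>2"
  interpret six_vertex_boundary_limit \<beta>\<^sub>1 \<beta>\<^sub>2 A B \<gamma> b q lft btm chi psi
  proof
    show "\<gamma> = \<beta>\<^sub>1 - \<beta>\<^sub>2" "\<gamma> \<noteq> 0" using assms(3) by (simp_all add: \<gamma>_def)
  qed (fact assms)+
  have powr: "\<qq> powr t = exp (\<gamma> * t)" for t
    using assms(4) by (simp add: powr_def \<gamma>_def mult.commute)
  obtain f where f: "approx 0 f"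
    and pos: "\<And>x y. x \<in> {0..A} \<Longrightarrow> y \<in> {0..B} \<Longrightarrow> exp (- \<bar>\<gamma>\<bar> * (A + B)) \<le> f x y"
    by (rule limit_solution) blast
  define h where "h = (\<lambda>x y. ln (f x y) / \<gamma>)"
  have h: "f x y = exp (\<gamma> * h x y)" if "x \<in> {0..A}" "y \<in> {0..B}" for x y
  proof -
    have "0 < f x y" using pos[OF that] by (rule less_le_trans[OF exp_gt_zero])
    then show ?thesis using \<gamma>(2) by (simp add: h_def)
  qed
  have sol: "approx 0 (\<lambda>x y. exp (\<gamma> * h x y))"
    by (rule approx_solution_cong[OF h _ _ f]) (use AB in auto)
  show ?thesis
    unfolding powr approx_solution_0_iff[symmetric]
  proof (intro exI[of _ h] conjI sol allI impI ballI)
    fix f' x y assume "approx 0 f'" and xy: "x \<in> {0..A}" "y \<in> {0..B}"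
    from approx_solution_stability[OF \<beta> this(1) sol xy] show "f' x y = exp (\<gamma> * h x y)" by simp
  next
    show "tendsto_0_in_probability (\<lambda>L. six_vertex_space (b L) (q L))
       (\<lambda>L \<omega>. SUP (x, y)\<in>{0..A} \<times> {0..B}.
          \<bar>height_xy (lft L) (btm L) \<omega> (L * x) (L * y) / L - h x y\<bar>) at_top"
      unfolding h_def by (rule law_of_large_numbers[OF f pos])
  qed
qed

end
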